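(* Let $\{\mathbf{g}_1,\dots,\mathbf{g}_t\}\subset\bigoplus_{i=1}^mR\mathbf{e}_i$ be an $(\Omega,k)$-Gröbner basis consisting of nonzero homogeneous monic vectors. Then $\mathrm{Syz}_{\Omega,k}(\mathbf{g}_1,\dots,\mathbf{g}_t)$ is $(\Omega,k)$-generated by $$\{\mathbf{s}_{ij} : i,j\in\{1,\dots,t\}\}\ \cup\ \{\mathbf{s}_i(\omega;z,p,q) : i\in\{1,\dots,t\},\ \omega\in\Omega,\ |\omega|\le k,\ (z,p,q)\in C(\mathbf{g}_i;\omega)\},$$ where the vectors $\mathbf{s}_{ij}$ and $\mathbf{s}_i(\omega;z,p,q)$ are as defined in the context.
   Context: Ring. $K$ is a field, $R=K\langle x_1,x_2,\dots\rangle$ a free noncommutative graded $K$-algebra with $|x_i|=a_i>0$. A monomial ordering on $R$ is a well-ordering on monomials (words) such that $X<Y$ implies $UXV<UYV$ for all monomials $U,V$, and $X=UYV$ with $U\ne1$ or $V\ne1$ implies $Y<X$; one is fixed. $\mathrm{lm},\mathrm{lc},\mathrm{lt}$ denote leading monomial, coefficient and term (all $0$ for the zero element). Modules. Modules are left modules. $\bigoplus_{i=1}^mR\mathbf{e}_i$ is a free graded $R$-module whose basis element $\mathbf{e}_i$ has degree $|\mathbf{e}_i|$. A monomial in it is $X\mathbf{e}_i$ with $X$ a monomial of $R$. $X\mathbf{e}_i$ divides $Y\mathbf{e}_j$ if $i=j$ and $Y=ZX$ for a monomial $Z$; then $\frac{Y\mathbf{e}_j}{X\mathbf{e}_i}=Z$.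 For monomials $\mathbf{X},\mathbf{Y}$, $\mathrm{lcm}(\mathbf{X},\mathbf{Y})$ is $\mathbf{Y}$ if $\mathbf{X}$ divides $\mathbf{Y}$, is $\mathbf{X}$ if $\mathbf{Y}$ divides $\mathbf{X}$, and is $0$ otherwise; $\frac{0}{\mathbf{X}}=0$. A term order on the module monomials is fixed, that is, a well-ordering such that $\mathbf{X}<\mathbf{Y}$ implies $Z\mathbf{X}<Z\mathbf{Y}$ for every monomial $Z$ of $R$, and $\mathbf{X}<Z\mathbf{X}$ for every monomial $Z\neq1$ of $R$. Leading data of vectors are taken with respect to it; $\mathbf{g}$ is monic if $\mathrm{lc}(\mathbf{g})=1$. $\Omega$. $k$ is a positive integer; $\Omega\subset R$ is a set of nonzero homogeneous polynomials that is a Gröbner basis of the two-sided ideal $\langle\Omega\rangle$ (the leading monomial of each nonzero element of $\langle\Omega\rangle$ has the form $U\,\mathrm{lm}(\omega)V$ with $\omega\in\Omega$ and $U,V$ monomials). $\Omega(l)=\Omega\cup\{g\in R: g\text{ homogeneous},\,|g|>l\}$ and $\langle\Omega(l)\rangle$ is the two-sided ideal it generates. $(\Omega,k)$-generation. A submodule $M\subset\bigoplus_{i=1}^mR\mathbf{e}_i$ is $(\Omega,k)$-generated by $F$, written $M=\langle F\rangle_{\Omega,k}$, if $M=\{\sum_jp_j\mathbf{f}_j+\sum_{i=1}^mq_i\mathbf{e}_i: p_j\in R,\mathbf{f}_j\in F,q_i\in\langle\Omega(k-|\mathbf{e}_i|)\rangle\}$ (finite sums). Nonzero vectors $\mathbf{g}_1,\dots,\mathbf{g}_t$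 form an $(\Omega,k)$-Gröbner basis (for $M=\langle\mathbf{g}_1,\dots,\mathbf{g}_t\rangle_{\Omega,k}$) if for every nonzero $\mathbf{f}\in M$, either some $\mathrm{lm}(\mathbf{g}_i)$ divides $\mathrm{lm}(\mathbf{f})$, or there are $j$ and a nonzero $q\in\langle\Omega(k-|\mathbf{e}_j|)\rangle$ with $\mathrm{lm}(q\mathbf{e}_j)$ dividing $\mathrm{lm}(\mathbf{f})$. Syzygies. Let $N=\bigoplus_{i=1}^tR\mathbf{e}'_i$ with $|\mathbf{e}'_i|=|\mathbf{g}_i|$ and $\varphi\colon N\to\bigoplus_{i=1}^mR\mathbf{e}_i$ the $R$-homomorphism with $\varphi(\mathbf{e}'_i)=\mathbf{g}_i$. Then $\mathrm{Syz}_{\Omega,k}(\mathbf{g}_1,\dots,\mathbf{g}_t)=\varphi^{-1}\big(\bigoplus_{i=1}^m\langle\Omega(k-|\mathbf{e}_i|)\rangle\mathbf{e}_i\big)\subset N$. ($(\Omega,k)$-generation in $N$ uses the degrees $|\mathbf{e}'_i|$.) The sets $C(\mathbf{f};g)$. For a nonzero vector $\mathbf{f}$ with $\mathrm{lm}(\mathbf{f})=x_{i_1}\cdots x_{i_n}\mathbf{e}_\mu$ and $g\in R$ with $\mathrm{lm}(g)=x_{j_1}\cdots x_{j_h}$, $C(\mathbf{f};g)$ is the set of triples of monomials consisting of: all $(1,\ x_{i_1}\cdots x_{i_\delta},\ x_{i_{\delta+h+1}}\cdots x_{i_n})$ with $0\le\delta\le n-h$ and $(i_{\delta+1},\dots,i_{\delta+h})=(j_1,\dots,j_h)$;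 and all $(x_{j_1}\cdots x_{j_\delta},\ 1,\ x_{i_{h-\delta+1}}\cdots x_{i_n})$ with $0\le\delta\le h$, $h-\delta\le n$ and $(i_1,\dots,i_{h-\delta})=(j_{\delta+1},\dots,j_h)$. The vectors $\mathbf{s}$. Put $\mathbf{X}_i=\mathrm{lm}(\mathbf{g}_i)$, $\mathbf{X}_{ij}=\mathrm{lcm}(\mathbf{X}_i,\mathbf{X}_j)$, and let $\mu_i$ be the index with $\mathbf{X}_i\in R\mathbf{e}_{\mu_i}$. Set $S(\mathbf{g}_i,\mathbf{g}_j)=\frac{\mathbf{X}_{ij}}{\mathbf{X}_i}\mathbf{g}_i-\frac{\mathbf{X}_{ij}}{\mathbf{X}_j}\mathbf{g}_j$ and, for $(z,p,q)\in C(\mathbf{g}_i;\omega)$, $S(\mathbf{g}_i,\omega;z,p,q)=z\mathbf{g}_i-p\,\omega\,q\,\mathbf{e}_{\mu_i}$. Write each such vector $S$, by division with respect to the $(\Omega,k)$-Gröbner basis, as a finite sum $S=\sum_{\nu=1}^tu_\nu\mathbf{g}_\nu+\sum_\epsilon p_\epsilon\omega_\epsilon q_\epsilon\mathbf{e}_{i_\epsilon}$ with $u_\nu,p_\epsilon,q_\epsilon\in R$, $\omega_\epsilon\in\Omega(k-|\mathbf{e}_{i_\epsilon}|)$ and $\max\{\max_\nu\mathrm{lm}(u_\nu)\mathrm{lm}(\mathbf{g}_\nu),\ \max_\epsilon\mathrm{lm}(p_\epsilon\omega_\epsilon q_\epsilon)\mathbf{e}_{i_\epsilon}\}=\mathrm{lm}(S)$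 (if $S=0$ all terms are zero). Denote the coefficients $u_\nu$ in the chosen representation by $u_{ij\nu}$ for $S(\mathbf{g}_i,\mathbf{g}_j)$ and by $h'_{i\nu}$ for $S(\mathbf{g}_i,\omega;z,p,q)$, and define $\mathbf{s}_{ij}=\frac{\mathbf{X}_{ij}}{\mathbf{X}_i}\mathbf{e}'_i-\frac{\mathbf{X}_{ij}}{\mathbf{X}_j}\mathbf{e}'_j-\sum_\nu u_{ij\nu}\mathbf{e}'_\nu$ and $\mathbf{s}_i(\omega;z,p,q)=z\mathbf{e}'_i-\sum_\nu h'_{i\nu}\mathbf{e}'_\nu$.
   Formalization: Added, since the claim fails otherwise: the term order is compatible with the ring ordering (X<Y implies Xe_i<Ye_i), the elements of Ω are monic, and the degrees |e_i| are nonnegative integers. The chosen representations are arbitrary admissible ones; m and t are at least 1. *)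

theory Defs
  imports "HOL-Analysis.Finite_Cartesian_Product" "HOL-Library.Poly_Mapping" "HOL-Library.Countable"
begin

section \<open>The free algebra\<close>

text \<open>
  Words in the variables form the free monoid. It is written additively, because the
  convolution product of \<^theory>\<open>HOL-Library.Poly_Mapping\<close> turns finitely supported functions on an
  additive (not necessarily commutative) monoid into a ring: \<open>0\<close> is the empty word (the
  monomial 1) and \<open>X + Y\<close> is the concatenation \<open>XY\<close>. The free algebra is the resulting
  monoid algebra.
\<close>

datatype 'x mon = Mon (letters: "'x list")

instantiation mon :: (type) monoid_add
begin

definition zero_mon :: "'x mon" where
  "zero_mon = Mon []"

definition plus_mon :: "'x mon \<Rightarrow> 'x mon \<Rightarrow> 'x mon" where
  "plus_mon X Y = Mon (letters X @ letters Y)"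

instance
  by standard (auto simp: zero_mon_def plus_mon_def)

end

type_synonym ('x, 'k) falg = "'x mon \<Rightarrow>\<^sub>0 'k"

abbreviation of_mon :: "'x mon \<Rightarrow> ('x, 'k::field) falg" where
  "of_mon X \<equiv> Poly_Mapping.single X 1"

definition mdeg :: "('x \<Rightarrow> nat) \<Rightarrow> 'x mon \<Rightarrow> nat" where
  "mdeg a X = sum_list (map a (letters X))"

definition homogeneous :: "('x \<Rightarrow> nat) \<Rightarrow> nat \<Rightarrow> ('x, 'k::field) falg \<Rightarrow> bool" where
  "homogeneous a d f \<longleftrightarrow> (\<forall>X \<in> Poly_Mapping.keys f. mdeg a X = d)"

definition two_sided_ideal :: "'r::ring_1 set \<Rightarrow> bool" where
  "two_sided_ideal I \<longleftrightarrow>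
     0 \<in> I \<and> (\<forall>x\<in>I. \<forall>y\<in>I. x + y \<in> I) \<and> (\<forall>x\<in>I. \<forall>r. r * x \<in> I \<and> x * r \<in> I)"

section \<open>Orderings and leading data\<close>

text \<open>Orderings are given by their reflexive relation: \<open>(X, Y) \<in> r\<close> means \<open>X \<le> Y\<close>.\<close>

definition less_in :: "'b rel \<Rightarrow> 'b \<Rightarrow> 'b \<Rightarrow> bool" where
  "less_in r X Y \<longleftrightarrow> (X, Y) \<in> r \<and> X \<noteq> Y"

definition monomial_ordering :: "'x mon rel \<Rightarrow> bool" where
  "monomial_ordering r \<longleftrightarrow> well_order r \<and>
     (\<forall>X Y U V. less_in r X Y \<longrightarrow> less_in r (U + X + V) (U + Y + V)) \<and>
     (\<forall>X Y U V. X = U + Y + V \<and> (U \<noteq> 0 \<or> V \<noteq> 0) \<longrightarrow> less_in r Y X)"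

text \<open>
  The free module on basis elements indexed by the finite type \<open>'m\<close> is \<open>('x, 'k) falg ^ 'm\<close>,
  with basis elements \<open>axis i 1\<close> and left scalar multiplication \<open>*s\<close>.
  The pair \<open>(X, i)\<close> represents the module monomial \<open>X e\<^sub>i\<close>.
\<close>

type_synonym ('x, 'm) mmon = "'x mon \<times> 'm"

definition mact :: "'x mon \<Rightarrow> ('x, 'm) mmon \<Rightarrow> ('x, 'm) mmon" where
  "mact Z \<XX> = (Z + fst \<XX>, snd \<XX>)"

definition term_order :: "('x, 'm) mmon rel \<Rightarrow> bool" where
  "term_order r \<longleftrightarrow> well_order r \<and>
     (\<forall>\<XX> \<YY> Z. less_in r \<XX> \<YY> \<longrightarrow> less_in r (mact Z \<XX>) (mact Z \<YY>)) \<and>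
     (\<forall>\<XX> Z. Z \<noteq> 0 \<longrightarrow> less_in r \<XX> (mact Z \<XX>))"

definition is_greatest :: "'b rel \<Rightarrow> 'b set \<Rightarrow> 'b \<Rightarrow> bool" where
  "is_greatest r A x \<longleftrightarrow> x \<in> A \<and> (\<forall>y\<in>A. (y, x) \<in> r)"

text \<open>
  Leading monomials are only meaningful for nonzero arguments; the convention that the leading
  monomial of zero is zero is rendered below by leaving zero terms out.
\<close>

definition lm :: "'x mon rel \<Rightarrow> ('x, 'k::field) falg \<Rightarrow> 'x mon" where
  "lm r f = (THE X. is_greatest r (Poly_Mapping.keys f) X)"

definition lc :: "'x mon rel \<Rightarrow> ('x, 'k::field) falg \<Rightarrow> 'k" where
  "lc r f = Poly_Mapping.lookup f (lm r f)"

definition vkeys :: "('x, 'k::field) falg ^ 'm \<Rightarrow> ('x, 'm::finite) mmon set" where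
  "vkeys v = {(X, i). X \<in> Poly_Mapping.keys (v $ i)}"

definition vlm :: "('x, 'm) mmon rel \<Rightarrow> ('x, 'k::field) falg ^ 'm \<Rightarrow> ('x, 'm::finite) mmon" where
  "vlm r v = (THE \<XX>. is_greatest r (vkeys v) \<XX>)"

definition vlc :: "('x, 'm) mmon rel \<Rightarrow> ('x, 'k::field) falg ^ 'm::finite \<Rightarrow> 'k" where
  "vlc r v = Poly_Mapping.lookup (v $ snd (vlm r v)) (fst (vlm r v))"

definition mdivides :: "('x, 'm) mmon \<Rightarrow> ('x, 'm) mmon \<Rightarrow> bool" where
  "mdivides \<XX> \<YY> \<longleftrightarrow> (\<exists>Z. \<YY> = mact Z \<XX>)"

text \<open>\<open>None\<close> plays the role of \<open>lcm = 0\<close>, and the quotient of \<open>None\<close> is \<open>0\<close>.\<close>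

definition mlcm :: "('x, 'm) mmon \<Rightarrow> ('x, 'm) mmon \<Rightarrow> ('x, 'm) mmon option" where
  "mlcm \<XX> \<YY> = (if mdivides \<XX> \<YY> then Some \<YY> else if mdivides \<YY> \<XX> then Some \<XX> else None)"

definition mquot :: "('x, 'm) mmon option \<Rightarrow> ('x, 'm) mmon \<Rightarrow> ('x, 'k::field) falg" where
  "mquot L \<XX> = (case L of None \<Rightarrow> 0 | Some \<YY> \<Rightarrow> of_mon (THE Z. \<YY> = mact Z \<XX>))"

definition vhomogeneous ::
  "('x \<Rightarrow> nat) \<Rightarrow> ('m \<Rightarrow> nat) \<Rightarrow> nat \<Rightarrow> ('x, 'k::field) falg ^ 'm::finite \<Rightarrow> bool" where
  "vhomogeneous a e d v \<longleftrightarrow> (\<forall>(X, i) \<in> vkeys v. mdeg a X + e i = d)"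

definition vdeg :: "('x \<Rightarrow> nat) \<Rightarrow> ('m \<Rightarrow> nat) \<Rightarrow> ('x, 'k::field) falg ^ 'm::finite \<Rightarrow> nat" where
  "vdeg a e v = (THE d. vhomogeneous a e d v)"

section \<open>Generation and Groebner bases relative to \<open>\<Omega>\<close> and \<open>k\<close>\<close>

definition ideal_groebner_basis :: "'x mon rel \<Rightarrow> ('x, 'k::field) falg set \<Rightarrow> bool" where
  "ideal_groebner_basis r \<Omega> \<longleftrightarrow>
     (\<forall>f \<in> two_sided_ideal hull \<Omega>. f \<noteq> 0 \<longrightarrow> (\<exists>\<omega>\<in>\<Omega>. \<exists>U V. lm r f = U + lm r \<omega> + V))"

text \<open>The bound is an integer, since \<open>k - |e\<^sub>i|\<close> may be negative.\<close>

definition Omega_upto ::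
  "('x \<Rightarrow> nat) \<Rightarrow> ('x, 'k::field) falg set \<Rightarrow> int \<Rightarrow> ('x, 'k) falg set" where
  "Omega_upto a \<Omega> l = \<Omega> \<union> {g. \<exists>d. homogeneous a d g \<and> int d > l}"

definition Omega_ideal ::
  "('x \<Rightarrow> nat) \<Rightarrow> ('x, 'k::field) falg set \<Rightarrow> int \<Rightarrow> ('x, 'k) falg set" where
  "Omega_ideal a \<Omega> l = two_sided_ideal hull Omega_upto a \<Omega> l"

text \<open>The function \<open>e\<close> gives the degrees of the basis elements.\<close>

definition Omega_gen ::
  "('x \<Rightarrow> nat) \<Rightarrow> ('m \<Rightarrow> nat) \<Rightarrow> ('x, 'k::field) falg set \<Rightarrow> nat \<Rightarrow>
   (('x, 'k) falg ^ 'm::finite) set \<Rightarrow> (('x, 'k) falg ^ 'm) set" where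
  "Omega_gen a e \<Omega> k F =
     {(\<Sum>f\<in>A. p f *s f) + (\<Sum>i\<in>UNIV. q i *s axis i 1) | A p q.
        finite A \<and> A \<subseteq> F \<and> (\<forall>i. q i \<in> Omega_ideal a \<Omega> (int k - int (e i)))}"

definition Omega_groebner_basis ::
  "('x \<Rightarrow> nat) \<Rightarrow> ('m \<Rightarrow> nat) \<Rightarrow> ('x, 'm) mmon rel \<Rightarrow> ('x, 'k::field) falg set \<Rightarrow> nat \<Rightarrow>
   ('t \<Rightarrow> ('x, 'k) falg ^ 'm::finite) \<Rightarrow> bool" where
  "Omega_groebner_basis a e r \<Omega> k g \<longleftrightarrow>
     (\<forall>i. g i \<noteq> 0) \<and>
     (\<forall>f \<in> Omega_gen a e \<Omega> k (range g). f \<noteq> 0 \<longrightarrow>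
        (\<exists>i. mdivides (vlm r (g i)) (vlm r f)) \<or>
        (\<exists>j. \<exists>q \<in> Omega_ideal a \<Omega> (int k - int (e j)).
           q \<noteq> 0 \<and> mdivides (vlm r (q *s axis j 1)) (vlm r f)))"

section \<open>Syzygies\<close>

definition syz_map ::
  "('t::finite \<Rightarrow> ('x, 'k::field) falg ^ 'm::finite) \<Rightarrow> ('x, 'k) falg ^ 't \<Rightarrow> ('x, 'k) falg ^ 'm" where
  "syz_map g v = (\<Sum>i\<in>UNIV. v $ i *s g i)"

definition Omega_syz ::
  "('x \<Rightarrow> nat) \<Rightarrow> ('m \<Rightarrow> nat) \<Rightarrow> ('x, 'k::field) falg set \<Rightarrow> nat \<Rightarrow>
   ('t::finite \<Rightarrow> ('x, 'k) falg ^ 'm::finite) \<Rightarrow> (('x, 'k) falg ^ 't) set" where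
  "Omega_syz a e \<Omega> k g =
     {v. \<forall>i. syz_map g v $ i \<in> Omega_ideal a \<Omega> (int k - int (e i))}"

text \<open>
  \<open>overlaps xs ys\<close> is the set \<open>C(f; g)\<close>, where \<open>xs\<close> are the letters of the leading monomial of
  \<open>f\<close> and \<open>ys\<close> those of the leading monomial of \<open>g\<close>.
\<close>

definition overlaps :: "'x list \<Rightarrow> 'x list \<Rightarrow> ('x mon \<times> 'x mon \<times> 'x mon) set" where
  "overlaps xs ys =
     {(0, Mon (take \<delta> xs), Mon (drop (\<delta> + length ys) xs)) | \<delta>.
        \<delta> + length ys \<le> length xs \<and> take (length ys) (drop \<delta> xs) = ys} \<union>
     {(Mon (take \<delta> ys), 0, Mon (drop (length ys - \<delta>) xs)) | \<delta>.
        \<delta> \<le> length ys \<and> length ys - \<delta> \<le> length xs \<and> take (length ys - \<delta>) xs = drop \<delta> ys}"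

definition C_set ::
  "'x mon rel \<Rightarrow> ('x, 'm) mmon rel \<Rightarrow> ('x, 'k::field) falg ^ 'm::finite \<Rightarrow> ('x, 'k) falg \<Rightarrow>
   ('x mon \<times> 'x mon \<times> 'x mon) set" where
  "C_set ro mo f g = overlaps (letters (fst (vlm mo f))) (letters (lm ro g))"

definition S_pair ::
  "('x, 'm) mmon rel \<Rightarrow> ('t \<Rightarrow> ('x, 'k::field) falg ^ 'm::finite) \<Rightarrow> 't \<Rightarrow> 't \<Rightarrow> ('x, 'k) falg ^ 'm" where
  "S_pair mo g i j =
     (let \<XX> = vlm mo (g i); \<YY> = vlm mo (g j); L = mlcm \<XX> \<YY>
      in mquot L \<XX> *s g i - mquot L \<YY> *s g j)"

definition S_omega ::
  "('x, 'm) mmon rel \<Rightarrow> ('t \<Rightarrow> ('x, 'k::field) falg ^ 'm::finite) \<Rightarrow> 't \<Rightarrow> ('x, 'k) falg \<Rightarrow>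
   'x mon \<times> 'x mon \<times> 'x mon \<Rightarrow> ('x, 'k) falg ^ 'm" where
  "S_omega mo g i \<omega> = (\<lambda>(z, p, q).
     of_mon z *s g i - (of_mon p * \<omega> * of_mon q) *s axis (snd (vlm mo (g i))) 1)"

text \<open>
  \<open>standard_rep a ro mo e \<Omega> k g S u\<close>: the vector \<open>S\<close> has a representation of the kind obtained by
  division, in which the coefficients of the \<open>g \<nu>\<close> are the \<open>u \<nu>\<close>. The list \<open>ts\<close> holds the
  quadruples \<open>(p, \<omega>, q, i)\<close> of the second sum, and \<open>T\<close> is the set of the monomials
  whose maximum is required to be the leading monomial of \<open>S\<close>; it is empty iff all terms are zero.
\<close>

definition standard_rep ::
  "('x \<Rightarrow> nat) \<Rightarrow> 'x mon rel \<Rightarrow> ('x, 'm) mmon rel \<Rightarrow> ('m \<Rightarrow> nat) \<Rightarrow> ('x, 'k::field) falg set \<Rightarrow>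
   nat \<Rightarrow> ('t::finite \<Rightarrow> ('x, 'k) falg ^ 'm::finite) \<Rightarrow> ('x, 'k) falg ^ 'm \<Rightarrow>
   ('t \<Rightarrow> ('x, 'k) falg) \<Rightarrow> bool" where
  "standard_rep a ro mo e \<Omega> k g S u \<longleftrightarrow>
     (\<exists>ts :: (('x, 'k) falg \<times> ('x, 'k) falg \<times> ('x, 'k) falg \<times> 'm) list.
        (\<forall>(p, \<omega>, q, i) \<in> set ts. \<omega> \<in> Omega_upto a \<Omega> (int k - int (e i))) \<and>
        S = (\<Sum>\<nu>\<in>UNIV. u \<nu> *s g \<nu>) + (\<Sum>(p, \<omega>, q, i)\<leftarrow>ts. (p * \<omega> * q) *s axis i 1) \<and>
        (let T = {mact (lm ro (u \<nu>)) (vlm mo (g \<nu>)) | \<nu>. u \<nu> \<noteq> 0} \<union>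
                 {(lm ro (p * \<omega> * q), i) | p \<omega> q i. (p, \<omega>, q, i) \<in> set ts \<and> p * \<omega> * q \<noteq> 0}
         in if S = 0 then T = {} else is_greatest mo T (vlm mo S)))"

definition syz_pair ::
  "('x, 'm) mmon rel \<Rightarrow> ('t::finite \<Rightarrow> ('x, 'k::field) falg ^ 'm::finite) \<Rightarrow>
   ('t \<Rightarrow> ('x, 'k) falg) \<Rightarrow> 't \<Rightarrow> 't \<Rightarrow> ('x, 'k) falg ^ 't" where
  "syz_pair mo g u i j =
     (let \<XX> = vlm mo (g i); \<YY> = vlm mo (g j); L = mlcm \<XX> \<YY>
      in mquot L \<XX> *s axis i 1 - mquot L \<YY> *s axis j 1 - (\<Sum>\<nu>\<in>UNIV. u \<nu> *s axis \<nu> 1))"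

definition syz_omega ::
  "('t::finite \<Rightarrow> ('x, 'k::field) falg) \<Rightarrow> 't \<Rightarrow> 'x mon \<times> 'x mon \<times> 'x mon \<Rightarrow> ('x, 'k) falg ^ 't" where
  "syz_omega h i = (\<lambda>(z, p, q). of_mon z *s axis i 1 - (\<Sum>\<nu>\<in>UNIV. h \<nu> *s axis \<nu> 1))"

end

theory Submission
  imports Defs
begin

text \<open>
  The proof is Schreyer's argument on leading monomials of syzygies. Write \<open>X\<^sub>i\<close> for the leading
  monomial of \<open>g\<^sub>i\<close>, and order the monomials \<open>Z e'\<^sub>i\<close> of the source of \<open>\<phi>\<close> by comparing the \<open>Z X\<^sub>i\<close>,
  with ties broken by the index. This is a well-order (\<open>well_order_schreyer_order\<close>). The vectors
  \<open>S(g\<^sub>i, g\<^sub>j)\<close> and \<open>S(g\<^sub>i, \<omega>; z, p, q)\<close> are built so that two equal leading monomials cancel, and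
  in a standard representation all terms are bounded by the leading monomial of \<open>S\<close>. Hence the
  coefficients \<open>u\<close> and \<open>h\<close> do not affect the leading monomials of the proposed generators: that of
  \<open>s\<^sub>i\<^sub>j\<close> is the larger one of \<open>(X\<^sub>i\<^sub>j/X\<^sub>i) e'\<^sub>i\<close> and \<open>(X\<^sub>i\<^sub>j/X\<^sub>j) e'\<^sub>j\<close> (\<open>syz_pair_lead\<close>, for
  \<open>i\<close> different from \<open>j\<close> and a nonzero lcm), and that of \<open>s\<^sub>i(\<omega>; z, p, q)\<close> is \<open>z e'\<^sub>i\<close>
  (\<open>syz_omega_lead\<close>).

  Let \<open>v\<close> be a nonzero element of the syzygy module with leading monomial \<open>Z e'\<^sub>i\<close>. If \<open>v\<close> has another
  monomial \<open>W e'\<^sub>j\<close> with \<open>W X\<^sub>j = Z X\<^sub>i\<close>, then \<open>Z e'\<^sub>i\<close> is the leading monomial of a multiple of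
  \<open>s\<^sub>i\<^sub>j\<close>. Otherwise nothing can cancel \<open>Z X\<^sub>i\<close> in \<open>\<phi>(v)\<close>, so \<open>Z X\<^sub>i\<close> is the leading monomial of an
  element of \<open>\<langle>\<Omega>(k - |e\<^sub>\<mu>|)\<rangle> e\<^sub>\<mu>\<close> (\<open>leading_monomial_cases\<close>). Up to degree \<open>k - |e\<^sub>\<mu>|\<close> this ideal
  agrees with \<open>\<langle>\<Omega>\<rangle>\<close>, so by \<open>lm_Omega_ideal\<close> either the degree of \<open>Z\<close> exceeds \<open>k - |g\<^sub>i|\<close>, and
  \<open>Z e'\<^sub>i\<close> itself belongs to the part that \<open>(\<Omega>,k)\<close>-generation always provides, or \<open>Z X\<^sub>i\<close>
  contains \<open>lm \<omega>\<close> as a subword for some \<open>\<omega>\<close> of degree at most \<open>k\<close>. By \<open>subword_of_product_cases\<close>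
  the subword lies inside \<open>Z\<close>, and then a multiple of \<open>\<omega> e'\<^sub>i\<close> has leading monomial \<open>Z e'\<^sub>i\<close>,
  or it reaches \<open>X\<^sub>i\<close>, and then a multiple of some \<open>s\<^sub>i(\<omega>; z, p, q)\<close> has.

  In every case the leading term of \<open>v\<close> can be removed by subtracting an element of the generated
  module, and well-founded induction on the leading monomial finishes the proof
  (\<open>submodule_eq_by_reduction\<close>).
\<close>

section \<open>Words and orderings\<close>

lemma mon_right_cancel: "Y + X = Z + X \<longleftrightarrow> Y = (Z :: 'x mon)"
  by (cases X; cases Y; cases Z) (auto simp: plus_mon_def)

text \<open>This is Levi's lemma for the free monoid.\<close>

lemma mon_add_eq_add_cases:
  fixes A B C D :: "'x mon"
  assumes "A + B = C + D"
  obtains W where "A = C + W" "D = W + B" | W where "C = A + W" "B = W + D"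
proof -
  obtain a b c d where *: "A = Mon a" "B = Mon b" "C = Mon c" "D = Mon d"
    by (metis mon.exhaust)
  with assms have "a @ b = c @ d"
    by (simp add: plus_mon_def)
  then obtain w where "a = c @ w \<and> d = w @ b \<or> c = a @ w \<and> b = w @ d"
    by (auto simp: append_eq_append_conv2)
  then show thesis
    using that[of "Mon w"] by (auto simp: * plus_mon_def)
qed

lemma mdeg_add: "mdeg a (X + Y) = mdeg a X + mdeg a Y"
  by (simp add: mdeg_def plus_mon_def)

lemma mact_mact: "mact Z (mact W \<XX>) = mact (Z + W) \<XX>"
  by (simp add: mact_def add.assoc)

lemma mact_right_cancel: "mact Z \<XX> = mact W \<XX> \<longleftrightarrow> Z = W"
  by (simp add: mact_def mon_right_cancel)

lemma linear_order_total: "linear_order r \<Longrightarrow> less_in r X Y \<or> X = Y \<or> less_in r Y X"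
  by (auto simp: less_in_def order_on_defs total_on_def)

lemma linear_order_refl: "linear_order r \<Longrightarrow> (X, X) \<in> r"
  by (auto simp: order_on_defs refl_on_def)

lemma linear_order_le_iff: "linear_order r \<Longrightarrow> (X, Y) \<in> r \<longleftrightarrow> X = Y \<or> less_in r X Y"
  by (auto simp: less_in_def linear_order_refl)

lemma linear_order_asym: "linear_order r \<Longrightarrow> less_in r X Y \<Longrightarrow> \<not> less_in r Y X"
  by (auto simp: less_in_def order_on_defs antisym_def)

lemma linear_order_less_trans:
  "linear_order r \<Longrightarrow> less_in r X Y \<Longrightarrow> less_in r Y Z \<Longrightarrow> less_in r X Z"
  unfolding less_in_def order_on_defs by (metis antisymD transD)

lemma linear_order_le_less_trans:
  "linear_order r \<Longrightarrow> (X, Y) \<in> r \<Longrightarrow> less_in r Y Z \<Longrightarrow> less_in r X Z"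
  by (metis linear_order_le_iff linear_order_less_trans)

lemma linear_order_le_trans:
  "linear_order r \<Longrightarrow> (X, Y) \<in> r \<Longrightarrow> (Y, Z) \<in> r \<Longrightarrow> (X, Z) \<in> r"
  by (metis order_on_defs(1,2,3) transD)

lemma is_greatest_exists:
  assumes "linear_order r" "finite A" "A \<noteq> {}"
  shows "\<exists>x. is_greatest r A x"
  using assms(2,3)
proof (induction rule: finite_ne_induct)
  case (singleton x)
  then show ?case
    using assms(1) by (auto simp: is_greatest_def linear_order_refl)
next
  case (insert x F)
  then obtain y where y: "is_greatest r F y" by auto
  have "(x, y) \<in> r \<or> (y, x) \<in> r"
    using linear_order_total[OF assms(1)] linear_order_le_iff[OF assms(1)] by metis
  then show ?case
  proof
    assume "(x, y) \<in> r"
    then have "is_greatest r (insert x F) y"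
      using y by (auto simp: is_greatest_def)
    then show ?thesis ..
  next
    assume "(y, x) \<in> r"
    then have "is_greatest r (insert x F) x"
      using y linear_order_refl[OF assms(1)] linear_order_le_trans[OF assms(1)]
      by (auto simp: is_greatest_def)
    then show ?thesis ..
  qed
qed

lemma is_greatest_unique:
  "linear_order r \<Longrightarrow> is_greatest r A x \<Longrightarrow> is_greatest r A y \<Longrightarrow> x = y"
  by (auto simp: is_greatest_def order_on_defs antisym_def)

lemma The_is_greatest:
  assumes "linear_order r" "is_greatest r A x"
  shows "(THE y. is_greatest r A y) = x"
  using assms is_greatest_unique[OF assms(1)] by blast

lemma lm_is_greatest:
  "linear_order r \<Longrightarrow> f \<noteq> 0 \<Longrightarrow> is_greatest r (Poly_Mapping.keys f) (lm r f)"
  unfolding lm_def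
  using is_greatest_exists[of r "Poly_Mapping.keys f"] by (auto simp: The_is_greatest)

lemma lm_eqI: "linear_order r \<Longrightarrow> is_greatest r (Poly_Mapping.keys f) X \<Longrightarrow> lm r f = X"
  by (simp add: lm_def The_is_greatest)

section \<open>Supports of polynomials and vectors\<close>

lemma poly_mapping_sum_single:
  fixes f :: "'a \<Rightarrow>\<^sub>0 'b::comm_monoid_add"
  shows "f = (\<Sum>X\<in>Poly_Mapping.keys f. Poly_Mapping.single X (Poly_Mapping.lookup f X))"
  by (rule poly_mapping_eqI)
    (auto simp: lookup_sum lookup_single when_def in_keys_iff)

lemma poly_mapping_single_induct [case_names zero single add]:
  fixes f :: "'a \<Rightarrow>\<^sub>0 'b::comm_monoid_add"
  assumes "P 0" "\<And>X c. P (Poly_Mapping.single X c)" "\<And>f g. P f \<Longrightarrow> P g \<Longrightarrow> P (f + g)"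
  shows "P f"
proof -
  have "P (\<Sum>X\<in>A. Poly_Mapping.single X (Poly_Mapping.lookup f X))" if "finite A" for A
    using that by (induction rule: finite_induct) (auto intro: assms)
  from this[of "Poly_Mapping.keys f"] show ?thesis
    using poly_mapping_sum_single[of f] by simp
qed

lemma finite_vkeys: "finite (vkeys v)"
proof (rule finite_subset)
  show "vkeys v \<subseteq> (\<Union>i. Poly_Mapping.keys (v $ i)) \<times> UNIV"
    by (auto simp: vkeys_def)
qed auto

lemma vkeys_eq_empty: "vkeys v = {} \<longleftrightarrow> v = 0"
proof
  assume "vkeys v = {}"
  then have "Poly_Mapping.keys (v $ i) = {}" for i
    unfolding vkeys_def by blast
  then show "v = 0" by (simp add: vec_eq_iff)
qed (simp add: vkeys_def)

lemma vkeys_zero [simp]: "vkeys 0 = {}"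
  by (simp add: vkeys_eq_empty)

lemma vlm_is_greatest: "linear_order r \<Longrightarrow> v \<noteq> 0 \<Longrightarrow> is_greatest r (vkeys v) (vlm r v)"
  unfolding vlm_def
  using is_greatest_exists[of r "vkeys v"] by (auto simp: The_is_greatest finite_vkeys vkeys_eq_empty)

lemma vkeys_add: "vkeys (v + w) \<subseteq> vkeys v \<union> vkeys w"
  using keys_add by (fastforce simp: vkeys_def)

lemma vkeys_diff: "vkeys (v - w) \<subseteq> vkeys v \<union> vkeys w"
  using keys_diff by (fastforce simp: vkeys_def)

lemma vkeys_add_subset: "vkeys v \<subseteq> S \<Longrightarrow> vkeys w \<subseteq> S \<Longrightarrow> vkeys (v + w) \<subseteq> S"
  using vkeys_add[of v w] by blast

lemma vkeys_diff_subset: "vkeys v \<subseteq> S \<Longrightarrow> vkeys w \<subseteq> S \<Longrightarrow> vkeys (v - w) \<subseteq> S"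
  using vkeys_diff[of v w] by blast

lemma vkeys_sum: "vkeys (\<Sum>i\<in>A. v i) \<subseteq> (\<Union>i\<in>A. vkeys (v i))"
proof (induction A rule: infinite_finite_induct)
  case (insert x F)
  then show ?case using vkeys_add[of "v x" "sum v F"] by auto
qed (auto simp: vkeys_def)

lemma vkeys_smult: "vkeys (p *s v) \<subseteq> {mact X \<YY> | X \<YY>. X \<in> Poly_Mapping.keys p \<and> \<YY> \<in> vkeys v}"
  using keys_mult by (fastforce simp: vkeys_def mact_def)

lemma vkeys_smult_axis: "vkeys (p *s axis i 1) = Poly_Mapping.keys p \<times> {i}"
  by (auto simp: vkeys_def axis_def split: if_splits)

text \<open>
  A module monomial as a vector. Products such as \<^term>\<open>of_mon Z *s mvec \<XX>\<close> are again of this form, so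
  \<^emph>\<open>monic with leading monomial \<open>\<XX>\<close>\<close> can be expressed by the condition that all monomials of
  \<open>v - mvec \<XX>\<close> are smaller than \<open>\<XX>\<close>. This condition is visibly preserved by multiplication by
  monomials, and no coefficients have to be extracted.
\<close>

definition mvec :: "('x, 'm) mmon \<Rightarrow> ('x, 'k::field) falg ^ 'm::finite" where
  "mvec \<XX> = of_mon (fst \<XX>) *s axis (snd \<XX>) 1"

lemma of_mon_smult_mvec: "of_mon Z *s mvec \<XX> = mvec (mact Z \<XX>)"
  by (simp add: mvec_def mact_def vector_smult_assoc mult_single)

lemma vkeys_mvec: "vkeys (mvec \<XX> :: ('x, 'k::field) falg ^ 'm::finite) = {\<XX>}"
  by (cases \<XX>) (simp add: mvec_def vkeys_smult_axis)

lemma vkeys_minus_lead: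
  fixes v :: "('x, 'k::field) falg ^ 'm::finite"
  assumes "\<XX> \<in> vkeys v" "c = Poly_Mapping.lookup (v $ snd \<XX>) (fst \<XX>)"
  shows "vkeys (v - Poly_Mapping.single 0 c *s mvec \<XX>) = vkeys v - {\<XX>}"
proof -
  obtain X i where X: "\<XX> = (X, i)" by (cases \<XX>)
  have *: "Poly_Mapping.lookup ((v - Poly_Mapping.single 0 c *s mvec \<XX>) $ j) Y =
      (if (Y, j) = \<XX> then 0 else Poly_Mapping.lookup (v $ j) Y)" for Y j
    using assms(2)
    by (simp add: X mvec_def axis_def mult_single lookup_minus lookup_single when_def)
  show ?thesis
    unfolding vkeys_def in_keys_iff * by auto
qed

section \<open>Ideals\<close>

lemma two_sided_ideal_hull: "two_sided_ideal (two_sided_ideal hull S)"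
  by (rule hull_in) (auto simp: two_sided_ideal_def)

lemma two_sided_ideal_sum:
  assumes "two_sided_ideal I" "\<And>i. i \<in> A \<Longrightarrow> f i \<in> I"
  shows "(\<Sum>i\<in>A. f i) \<in> I"
  using assms(2)
  by (induction A rule: infinite_finite_induct) (use assms(1) in \<open>auto simp: two_sided_ideal_def\<close>)

lemma two_sided_ideal_mult:
  assumes "two_sided_ideal I" "x \<in> I"
  shows "r * x \<in> I" "x * r \<in> I"
  using assms by (auto simp: two_sided_ideal_def)

lemma two_sided_ideal_Omega_ideal: "two_sided_ideal (Omega_ideal a \<Omega> l)"
  by (simp add: Omega_ideal_def two_sided_ideal_hull)

lemma Omega_upto_subset: "Omega_upto a \<Omega> l \<subseteq> Omega_ideal a \<Omega> l"
  by (simp add: Omega_ideal_def hull_subset)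

lemma high_degree_in_Omega_ideal:
  assumes "\<And>X. X \<in> Poly_Mapping.keys f \<Longrightarrow> l < int (mdeg a X)"
  shows "f \<in> Omega_ideal a \<Omega> l"
proof -
  have "Poly_Mapping.single X (Poly_Mapping.lookup f X) \<in> Omega_ideal a \<Omega> l"
    if "X \<in> Poly_Mapping.keys f" for X
  proof (rule subsetD[OF Omega_upto_subset])
    have "homogeneous a (mdeg a X) (Poly_Mapping.single X (Poly_Mapping.lookup f X))"
      by (auto simp: homogeneous_def)
    then show "Poly_Mapping.single X (Poly_Mapping.lookup f X) \<in> Omega_upto a \<Omega> l"
      using assms[OF that] by (auto simp: Omega_upto_def)
  qed
  then show ?thesis
    by (subst poly_mapping_sum_single) (auto intro: two_sided_ideal_sum two_sided_ideal_Omega_ideal)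
qed

text \<open>
  Multiplying by a polynomial without terms of degree less than \<open>d\<close> raises all degrees by at least
  \<open>d\<close>, also if a polynomial is inserted between the two factors.
  This is why \<open>\<phi>\<close> maps the part \<open>\<langle>\<Omega>(k - |g\<^sub>i|)\<rangle> e'\<^sub>i\<close> into the corresponding part of the target.
\<close>

lemma Omega_ideal_times_high_degree:
  fixes f :: "('x, 'k::field) falg"
  assumes "f \<in> Omega_ideal a \<Omega> (l - int d)"
    and "\<And>X. X \<in> Poly_Mapping.keys c \<Longrightarrow> d \<le> mdeg a X"
  shows "f * c \<in> Omega_ideal a \<Omega> l"
proof -
  define J where "J = {f. \<forall>c. (\<forall>X\<in>Poly_Mapping.keys c. d \<le> mdeg a X) \<longrightarrow> f * c \<in> Omega_ideal a \<Omega> l}"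
  note I = two_sided_ideal_Omega_ideal[of a \<Omega> l]
  have high: "\<forall>X\<in>Poly_Mapping.keys (r * c). d \<le> mdeg a X"
    if "\<forall>X\<in>Poly_Mapping.keys c. d \<le> mdeg a X" for r c :: "('x, 'k) falg"
    using that keys_mult[of r c] by (fastforce simp: mdeg_add)
  have "Omega_ideal a \<Omega> (l - int d) \<subseteq> J"
    unfolding Omega_ideal_def[of a \<Omega> "l - int d"]
  proof (rule hull_minimal)
    show "Omega_upto a \<Omega> (l - int d) \<subseteq> J"
    proof
      fix f assume "f \<in> Omega_upto a \<Omega> (l - int d)"
      then consider "f \<in> \<Omega>" | n where "homogeneous a n f" "int n > l - int d"
        by (auto simp: Omega_upto_def)
      then show "f \<in> J"
      proof cases
        case 1
        then have "f \<in> Omega_ideal a \<Omega> l"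
          using Omega_upto_subset by (auto simp: Omega_upto_def)
        then show ?thesis
          using I by (auto simp: J_def two_sided_ideal_def)
      next
        case 2
        have "f * c \<in> Omega_ideal a \<Omega> l" if "\<forall>X\<in>Poly_Mapping.keys c. d \<le> mdeg a X" for c
        proof (rule high_degree_in_Omega_ideal)
          fix X assume "X \<in> Poly_Mapping.keys (f * c)"
          then obtain Y Z where "X = Y + Z" "Y \<in> Poly_Mapping.keys f" "Z \<in> Poly_Mapping.keys c"
            using keys_mult by fastforce
          with 2 that show "l < int (mdeg a X)"
            by (fastforce simp: mdeg_add homogeneous_def)
        qed
        then show ?thesis by (simp add: J_def)
      qed
    qed
    show "two_sided_ideal J"
      using I high by (auto simp: two_sided_ideal_def J_def distrib_right mult.assoc)
  qed
  with assms show ?thesis by (auto simp: J_def)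
qed

lift_definition hom_part :: "('x \<Rightarrow> nat) \<Rightarrow> nat \<Rightarrow> ('x, 'k::field) falg \<Rightarrow> ('x, 'k) falg"
  is "\<lambda>a d f X. f X when mdeg a X = d"
  by (rule finite_subset) (auto simp: when_def split: if_splits)

lemma keys_hom_part: "Poly_Mapping.keys (hom_part a d f) = {X \<in> Poly_Mapping.keys f. mdeg a X = d}"
  by transfer auto

lemma hom_part_add: "hom_part a d (f + g) = hom_part a d f + hom_part a d g"
  by transfer (auto simp: when_def)

lemma hom_part_zero: "hom_part a d 0 = 0"
  by transfer auto

lemma hom_part_single:
  "hom_part a d (Poly_Mapping.single X c) = (if mdeg a X = d then Poly_Mapping.single X c else 0)"
  by (rule poly_mapping_eqI) (auto simp: hom_part.rep_eq lookup_single when_def)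

lemma hom_part_homogeneous: "homogeneous a n f \<Longrightarrow> hom_part a d f = (if n = d then f else 0)"
  by (rule poly_mapping_eqI) (auto simp: hom_part.rep_eq homogeneous_def when_def in_keys_iff)

lemma hom_part_single_times:
  "hom_part a d (Poly_Mapping.single X c * f) =
     (if mdeg a X \<le> d then Poly_Mapping.single X c * hom_part a (d - mdeg a X) f else 0)"
  by (induction f rule: poly_mapping_single_induct)
    (auto simp: hom_part_zero hom_part_single mult_single mdeg_add hom_part_add distrib_left)

lemma hom_part_times_single:
  "hom_part a d (f * Poly_Mapping.single X c) =
     (if mdeg a X \<le> d then hom_part a (d - mdeg a X) f * Poly_Mapping.single X c else 0)"
  by (induction f rule: poly_mapping_single_induct)
    (auto simp: hom_part_zero hom_part_single mult_single mdeg_add hom_part_add distrib_right)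

text \<open>
  Up to degree \<open>l\<close> the ideal \<open>\<langle>\<Omega>(l)\<rangle>\<close> agrees with \<open>\<langle>\<Omega>\<rangle>\<close>: the polynomials added to \<open>\<Omega>\<close>
  contribute only to degrees above \<open>l\<close>.
\<close>

lemma hom_part_Omega_ideal:
  fixes \<Omega> :: "('x, 'k::field) falg set"
  assumes "\<And>\<omega>. \<omega> \<in> \<Omega> \<Longrightarrow> \<exists>n. homogeneous a n \<omega>"
    and "f \<in> Omega_ideal a \<Omega> l" "int d \<le> l"
  shows "hom_part a d f \<in> two_sided_ideal hull \<Omega>"
proof -
  define J where "J = {f. \<forall>d. int d \<le> l \<longrightarrow> hom_part a d f \<in> two_sided_ideal hull \<Omega>}"
  note I = two_sided_ideal_hull[of \<Omega>]
  have 0: "0 \<in> two_sided_ideal hull \<Omega>"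
    using I by (auto simp: two_sided_ideal_def)
  have add: "f + g \<in> J" if "f \<in> J" "g \<in> J" for f g
    using that I by (auto simp: J_def hom_part_add two_sided_ideal_def)
  have mult: "r * f \<in> J \<and> f * r \<in> J" if f: "f \<in> J" for r f
  proof (induction r rule: poly_mapping_single_induct)
    case (single X c)
    show ?case
      using f 0 by (auto simp: J_def hom_part_single_times hom_part_times_single
          intro: two_sided_ideal_mult[OF I])
  qed (use 0 in \<open>auto simp: distrib_left distrib_right add J_def hom_part_zero\<close>,
       use add in \<open>auto simp: J_def\<close>)
  have "Omega_ideal a \<Omega> l \<subseteq> J"
    unfolding Omega_ideal_def
  proof (rule hull_minimal)
    show "Omega_upto a \<Omega> l \<subseteq> J"
      using assms(1) 0
      by (force simp: Omega_upto_def J_def hom_part_homogeneous intro: hull_inc)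
    have "0 \<in> J"
      using 0 by (simp add: J_def hom_part_zero)
    then show "two_sided_ideal J"
      using add mult by (auto simp: two_sided_ideal_def)
  qed
  with assms(2,3) show ?thesis by (auto simp: J_def)
qed

text \<open>
  The homogeneous component of \<open>f\<close> that contains the leading monomial of \<open>f\<close> has the same leading
  monomial. If its degree is at most \<open>l\<close>, it lies in \<open>\<langle>\<Omega>\<rangle>\<close>, and the Groebner basis property of
  \<open>\<Omega>\<close> applies to it.
\<close>

lemma lm_Omega_ideal:
  fixes \<Omega> :: "('x, 'k::field) falg set"
  assumes ro: "linear_order ro"
    and \<Omega>: "\<forall>\<omega>\<in>\<Omega>. \<omega> \<noteq> 0 \<and> (\<exists>n. homogeneous a n \<omega>)"
    and gb: "ideal_groebner_basis ro \<Omega>"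
    and f: "f \<in> Omega_ideal a \<Omega> l" "f \<noteq> 0"
  obtains "l < int (mdeg a (lm ro f))"
  | \<omega> U V d where "\<omega> \<in> \<Omega>" "homogeneous a d \<omega>" "int d \<le> l" "lm ro f = U + lm ro \<omega> + V"
proof (cases "l < int (mdeg a (lm ro f))")
  case False
  define D where "D = mdeg a (lm ro f)"
  have gr: "is_greatest ro (Poly_Mapping.keys f) (lm ro f)"
    using lm_is_greatest[OF ro f(2)] .
  then have gr': "is_greatest ro (Poly_Mapping.keys (hom_part a D f)) (lm ro f)"
    by (auto simp: is_greatest_def keys_hom_part D_def)
  then have lm': "lm ro (hom_part a D f) = lm ro f"
    by (rule lm_eqI[OF ro])
  have "hom_part a D f \<in> two_sided_ideal hull \<Omega>"
    using \<Omega> f(1) False by (intro hom_part_Omega_ideal) (auto simp: D_def)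
  moreover have "hom_part a D f \<noteq> 0"
    using gr' by (auto simp: is_greatest_def)
  ultimately obtain \<omega> U V where \<omega>: "\<omega> \<in> \<Omega>" "lm ro f = U + lm ro \<omega> + V"
    using gb lm' by (metis ideal_groebner_basis_def)
  then obtain n where n: "homogeneous a n \<omega>" using \<Omega> by blast
  have "lm ro \<omega> \<in> Poly_Mapping.keys \<omega>"
    using lm_is_greatest[OF ro] \<Omega> \<omega>(1) by (auto simp: is_greatest_def)
  then have "n = mdeg a (lm ro \<omega>)"
    using n by (auto simp: homogeneous_def)
  then have "n \<le> mdeg a (lm ro f)"
    by (simp add: \<omega>(2) mdeg_add)
  then show thesis
    using that(2)[OF \<omega>(1) n _ \<omega>(2)] False by linarith
qed (use that(1) in simp)

section \<open>Submodules\<close>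

definition left_submodule :: "('r::ring_1 ^ 'm) set \<Rightarrow> bool" where
  "left_submodule M \<longleftrightarrow> 0 \<in> M \<and> (\<forall>v\<in>M. \<forall>w\<in>M. v + w \<in> M) \<and> (\<forall>r. \<forall>v\<in>M. r *s v \<in> M)"

lemma left_submoduleD:
  assumes "left_submodule M"
  shows "0 \<in> M" "\<And>v w. v \<in> M \<Longrightarrow> w \<in> M \<Longrightarrow> v + w \<in> M" "\<And>r v. v \<in> M \<Longrightarrow> r *s v \<in> M"
    "\<And>v w. v \<in> M \<Longrightarrow> w \<in> M \<Longrightarrow> v - w \<in> M"
proof -
  show *: "0 \<in> M" "\<And>v w. v \<in> M \<Longrightarrow> w \<in> M \<Longrightarrow> v + w \<in> M" "\<And>r v. v \<in> M \<Longrightarrow> r *s v \<in> M"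
    using assms by (auto simp: left_submodule_def)
  show "v - w \<in> M" if "v \<in> M" "w \<in> M" for v w
    using *(2)[OF that(1) *(3)[OF that(2), of "- 1"]] by (simp flip: vector_sneg_minus1)
qed

lemma left_submodule_sum:
  assumes "left_submodule M" "\<And>i. i \<in> A \<Longrightarrow> f i \<in> M"
  shows "(\<Sum>i\<in>A. f i) \<in> M"
  using assms(2)
  by (induction A rule: infinite_finite_induct) (auto intro: left_submoduleD[OF assms(1)])

text \<open>
  \<^const>\<open>Omega_gen\<close> is described by finite sums. It is used through its universal property: it is the
  least left submodule containing the generators and the multiples of the basis vectors by elements
  of the respective ideals.
\<close>

lemma Omega_gen_minimal:
  assumes "left_submodule M" "F \<subseteq> M"
    and "\<And>i q. q \<in> Omega_ideal a \<Omega> (int k - int (e i)) \<Longrightarrow> q *s axis i 1 \<in> M"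
  shows "Omega_gen a e \<Omega> k F \<subseteq> M"
proof
  fix v assume "v \<in> Omega_gen a e \<Omega> k F"
  then obtain A p q where v: "v = (\<Sum>f\<in>A. p f *s f) + (\<Sum>i\<in>UNIV. q i *s axis i 1)"
    and A: "A \<subseteq> F" and q: "\<And>i. q i \<in> Omega_ideal a \<Omega> (int k - int (e i))"
    by (auto simp: Omega_gen_def)
  show "v \<in> M"
    unfolding v using A assms(2) q
    by (intro left_submoduleD(2)[OF assms(1)] left_submodule_sum[OF assms(1)])
      (auto intro: left_submoduleD(3)[OF assms(1)] assms(3))
qed

lemma left_submodule_Omega_gen: "left_submodule (Omega_gen a e \<Omega> k F)"
proof -
  let ?G = "Omega_gen a e \<Omega> k F"
  let ?I = "\<lambda>i. Omega_ideal a \<Omega> (int k - int (e i))"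
  have I: "two_sided_ideal (?I i)" for i by (rule two_sided_ideal_Omega_ideal)
  have "0 \<in> ?G"
    unfolding Omega_gen_def
    by (rule CollectI, rule exI[of _ "{}"], rule exI, rule exI[of _ "\<lambda>_. 0"])
      (use I in \<open>auto simp: two_sided_ideal_def\<close>)
  moreover have "v + w \<in> ?G" if vG: "v \<in> ?G" and wG: "w \<in> ?G" for v w
  proof -
    obtain A p q where v: "v = (\<Sum>f\<in>A. p f *s f) + (\<Sum>i\<in>UNIV. q i *s axis i 1)"
      and A: "finite A" "A \<subseteq> F" and q: "\<And>i. q i \<in> ?I i"
      using vG unfolding Omega_gen_def by blast
    obtain B p' q' where w: "w = (\<Sum>f\<in>B. p' f *s f) + (\<Sum>i\<in>UNIV. q' i *s axis i 1)"
      and B: "finite B" "B \<subseteq> F" and q': "\<And>i. q' i \<in> ?I i"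
      using wG unfolding Omega_gen_def by blast
    define p'' where "p'' f = (if f \<in> A then p f else 0) + (if f \<in> B then p' f else 0)" for f
    have "(\<Sum>f\<in>A. p f *s f) = (\<Sum>f\<in>A \<union> B. (if f \<in> A then p f else 0) *s f)"
      using A B by (intro sum.mono_neutral_cong_left) auto
    moreover have "(\<Sum>f\<in>B. p' f *s f) = (\<Sum>f\<in>A \<union> B. (if f \<in> B then p' f else 0) *s f)"
      using A B by (intro sum.mono_neutral_cong_left) auto
    ultimately have
      "v + w = (\<Sum>f\<in>A \<union> B. p'' f *s f) + (\<Sum>i\<in>UNIV. (q i + q' i) *s axis i 1)"
      unfolding v w p''_def vector_sadd_rdistrib sum.distrib by (simp add: algebra_simps)
    then show ?thesis
      unfolding Omega_gen_def using A B q q' I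
      by (intro CollectI exI[of _ "A \<union> B"] exI[of _ p''] exI[of _ "\<lambda>i. q i + q' i"])
        (auto simp: two_sided_ideal_def)
  qed
  moreover have "r *s v \<in> ?G" if vG: "v \<in> ?G" for r v
  proof -
    obtain A p q where v: "v = (\<Sum>f\<in>A. p f *s f) + (\<Sum>i\<in>UNIV. q i *s axis i 1)"
      and A: "finite A" "A \<subseteq> F" and q: "\<And>i. q i \<in> ?I i"
      using vG unfolding Omega_gen_def by blast
    have "r *s v = (\<Sum>f\<in>A. (r * p f) *s f) + (\<Sum>i\<in>UNIV. (r * q i) *s axis i 1)"
      unfolding v by (simp add: vec_eq_iff distrib_left sum_distrib_left mult.assoc)
    then show ?thesis
      unfolding Omega_gen_def using A q I
      by (intro CollectI exI[of _ A] exI[of _ "\<lambda>f. r * p f"] exI[of _ "\<lambda>i. r * q i"])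
        (auto simp: two_sided_ideal_def)
  qed
  ultimately show ?thesis by (simp add: left_submodule_def)
qed

lemma generator_in_Omega_gen: "f \<in> F \<Longrightarrow> f \<in> Omega_gen a e \<Omega> k F"
  unfolding Omega_gen_def
  by (rule CollectI, rule exI[of _ "{f}"], rule exI[of _ "\<lambda>_. 1"], rule exI[of _ "\<lambda>_. 0"])
    (use two_sided_ideal_Omega_ideal in \<open>auto simp: two_sided_ideal_def\<close>)

lemma ideal_part_in_Omega_gen:
  assumes "q \<in> Omega_ideal a \<Omega> (int k - int (e i))"
  shows "q *s axis i 1 \<in> Omega_gen a e \<Omega> k F"
proof -
  have "q *s axis i 1 = (\<Sum>j\<in>UNIV. (if j = i then q else 0) *s axis j 1)"
    by (simp add: if_distrib[of "\<lambda>x. x *s _"] cong: if_cong)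
  moreover have "0 \<in> Omega_ideal a \<Omega> (int k - int (e j))" for j
    using two_sided_ideal_Omega_ideal by (auto simp: two_sided_ideal_def)
  ultimately show ?thesis
    unfolding Omega_gen_def using assms
    by (intro CollectI exI[of _ "{}"] exI[of _ "\<lambda>_. 0"] exI[of _ "\<lambda>j. if j = i then q else 0"])
      auto
qed

lemma syz_map_add: "syz_map g (v + w) = syz_map g v + syz_map g w"
  by (simp add: syz_map_def vector_sadd_rdistrib sum.distrib)

lemma syz_map_diff: "syz_map g (v - w) = syz_map g v - syz_map g w"
  by (simp add: syz_map_def vector_sub_rdistrib sum_subtractf)

lemma syz_map_smult: "syz_map g (r *s v) = r *s syz_map g v"
  by (simp add: syz_map_def vec_eq_iff sum_distrib_left mult.assoc)

lemma syz_map_axis: "syz_map g (axis i 1) = g i"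
  by (simp add: syz_map_def axis_def if_distrib[of "\<lambda>x. x *s _"] cong: if_cong)

lemma left_submodule_Omega_syz: "left_submodule (Omega_syz a e \<Omega> k g)"
  using two_sided_ideal_Omega_ideal[of a \<Omega>]
  by (auto simp: left_submodule_def Omega_syz_def syz_map_add syz_map_smult two_sided_ideal_def)
    (simp add: syz_map_def)

section \<open>The Schreyer order\<close>

text \<open>
  This is the order induced on the monomials of the source of \<open>\<phi>\<close> by the leading monomials \<open>L i\<close> of the
  images of the basis elements: \<open>Z e'\<^sub>i\<close> is compared through \<open>Z L\<^sub>i\<close>. Ties are broken by an arbitrary
  enumeration of the finite index type, because a total order is needed to speak of leading monomials.
\<close>

definition schreyer_less ::
  "('x, 'm) mmon rel \<Rightarrow> ('t::finite \<Rightarrow> ('x, 'm) mmon) \<Rightarrow> ('x, 't) mmon \<Rightarrow> ('x, 't) mmon \<Rightarrow> bool" where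
  "schreyer_less r L A B \<longleftrightarrow>
     less_in r (mact (fst A) (L (snd A))) (mact (fst B) (L (snd B))) \<or>
     mact (fst A) (L (snd A)) = mact (fst B) (L (snd B)) \<and> to_nat (snd A) < to_nat (snd B)"

definition schreyer_order ::
  "('x, 'm) mmon rel \<Rightarrow> ('t::finite \<Rightarrow> ('x, 'm) mmon) \<Rightarrow> ('x, 't) mmon rel" where
  "schreyer_order r L = {(A, B). A = B \<or> schreyer_less r L A B}"

lemma less_in_schreyer_order: "less_in (schreyer_order r L) A B \<longleftrightarrow> schreyer_less r L A B"
  by (auto simp: less_in_def schreyer_order_def schreyer_less_def)

lemma well_order_schreyer_order:
  assumes "well_order r"
  shows "well_order (schreyer_order r L)"
proof -
  have r: "linear_order r" and wf: "wf (r - Id)"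
    using assms by (auto simp: well_order_on_def)
  \<comment> \<open>\<open>Z\<close> can be recovered from \<open>Z L\<^sub>i\<close> and \<open>i\<close>, so \<open>\<kappa>\<close> embeds the monomials into a
    lexicographic product of two well-orders.\<close>
  define \<kappa> where "\<kappa> A = (mact (fst A) (L (snd A)), to_nat (snd A))" for A
  have inj: "A = B" if "\<kappa> A = \<kappa> B" for A B
  proof -
    have "snd A = snd B"
      using that by (simp add: \<kappa>_def)
    moreover from this have "fst A = fst B"
      using that by (simp add: \<kappa>_def mact_right_cancel)
    ultimately show ?thesis by (rule prod_eqI[rotated])
  qed
  have eq: "schreyer_less r L A B \<longleftrightarrow> (\<kappa> A, \<kappa> B) \<in> (r - Id) <*lex*> less_than" for A B
    by (auto simp: schreyer_less_def \<kappa>_def less_in_def)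
  have trans: "schreyer_less r L A C" if "schreyer_less r L A B" "schreyer_less r L B C" for A B C
    using that unfolding schreyer_less_def
    by (elim disjE) (auto intro: linear_order_less_trans[OF r])
  have irrefl: "\<not> schreyer_less r L A A" for A
    by (simp add: schreyer_less_def less_in_def)
  have "schreyer_less r L A B \<or> A = B \<or> schreyer_less r L B A" for A B
    using linear_order_total[OF r] inj[of A B] unfolding schreyer_less_def \<kappa>_def
    by (metis linorder_less_linear)
  then have "linear_order (schreyer_order r L)"
    using trans irrefl unfolding order_on_defs schreyer_order_def
    by (auto simp: refl_on_def total_on_def intro!: transI antisymI) blast+
  moreover have "schreyer_order r L - Id = inv_image ((r - Id) <*lex*> less_than) \<kappa>"
    using irrefl by (auto simp: schreyer_order_def eq)
  then have "wf (schreyer_order r L - Id)"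
    using wf by (simp add: wf_lex_prod)
  ultimately show ?thesis by (simp add: well_order_on_def)
qed

text \<open>
  The reduction argument behind Groebner bases of modules: it suffices that \<open>G\<close> contains, for every
  nonzero element of \<open>M\<close>, a monic element with the same leading monomial.
\<close>

lemma submodule_eq_by_reduction:
  fixes M G :: "(('x, 'k::field) falg ^ 't::finite) set"
  assumes r: "well_order r" and M: "left_submodule M" and G: "left_submodule G" "G \<subseteq> M"
    and red: "\<And>v. v \<in> M \<Longrightarrow> v \<noteq> 0 \<Longrightarrow>
                \<exists>s\<in>G. \<forall>B\<in>vkeys (s - mvec (vlm r v)). less_in r B (vlm r v)"
  shows "M = G"
proof -
  have lin: "linear_order r" and wf: "wf (r - Id)"
    using r by (auto simp: well_order_on_def)
  have "\<forall>v. v \<in> M \<longrightarrow> v \<noteq> 0 \<longrightarrow> vlm r v = T \<longrightarrow> v \<in> G" for T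
    using wf
  proof (induction T rule: wf_induct_rule)
    case (less T)
    show ?case
    proof (intro allI impI)
      fix v assume v: "v \<in> M" "v \<noteq> 0" "vlm r v = T"
      obtain s where s: "s \<in> G" "\<And>B. B \<in> vkeys (s - mvec T) \<Longrightarrow> less_in r B T"
        using red[OF v(1,2)] v(3) by auto
      have top: "is_greatest r (vkeys v) T"
        using vlm_is_greatest[OF lin v(2)] v(3) by simp
      define c where "c = Poly_Mapping.lookup (v $ snd T) (fst T)"
      define w where "w = v - Poly_Mapping.single 0 c *s s"
      have "w = (v - Poly_Mapping.single 0 c *s mvec T) - Poly_Mapping.single 0 c *s (s - mvec T)"
        by (simp add: w_def vector_ssub_ldistrib)
      then have "vkeys w \<subseteq> (vkeys v - {T}) \<union> vkeys (Poly_Mapping.single 0 c *s (s - mvec T))"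
        using vkeys_diff vkeys_minus_lead[of T v c] top by (metis c_def is_greatest_def)
      moreover have "vkeys (Poly_Mapping.single 0 c *s (s - mvec T)) \<subseteq> vkeys (s - mvec T)"
        using vkeys_smult[of "Poly_Mapping.single 0 c" "s - mvec T"]
        by (auto simp: mact_def split: if_splits)
      ultimately have sub: "vkeys w \<subseteq> (vkeys v - {T}) \<union> vkeys (s - mvec T)"
        by blast
      have below: "less_in r B T" if "B \<in> vkeys w" for B
      proof -
        have "B \<in> vkeys (s - mvec T) \<or> B \<in> vkeys v \<and> B \<noteq> T"
          using that sub by blast
        then show ?thesis
          using s(2) top unfolding is_greatest_def less_in_def by blast
      qed
      have cs: "Poly_Mapping.single 0 c *s s \<in> G"
        using left_submoduleD[OF G(1)] s(1) by blast
      have "w \<in> M"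
        unfolding w_def using left_submoduleD(4)[OF M v(1)] cs G(2) by blast
      then have "w \<in> G"
      proof (cases "w = 0")
        case False
        then have "vlm r w \<in> vkeys w"
          using vlm_is_greatest[OF lin] by (auto simp: is_greatest_def)
        then have "(vlm r w, T) \<in> r - Id"
          using below by (auto simp: less_in_def)
        then show ?thesis
          using less.IH \<open>w \<in> M\<close> False by blast
      qed (use left_submoduleD(1)[OF G(1)] in simp)
      then have "w + Poly_Mapping.single 0 c *s s \<in> G"
        using cs left_submoduleD(2)[OF G(1)] by blast
      then show "v \<in> G" by (simp add: w_def)
    qed
  qed
  then show ?thesis
    using G(2) left_submoduleD(1)[OF G(1)] by blast
qed

section \<open>Common multiples and overlaps\<close>

text \<open>
  Two suffixes of one word are comparable, so \<^const>\<open>mlcm\<close> of two monomials with a common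
  multiple is not \<^const>\<open>None\<close>, and it divides every common multiple.
\<close>

lemma mlcm_common_multiple:
  fixes \<XX> \<YY> :: "('x, 'm) mmon"
  assumes "mact Z \<XX> = mact W \<YY>"
  obtains V P Q where "Z = V + P" "W = V + Q" "mact P \<XX> = mact Q \<YY>"
    "mquot (mlcm \<XX> \<YY>) \<XX> = (of_mon P :: ('x, 'k::field) falg)"
    "mquot (mlcm \<XX> \<YY>) \<YY> = (of_mon Q :: ('x, 'k::field) falg)"
proof -
  have quot: "mquot (Some (mact P \<ZZ>)) \<ZZ> = (of_mon P :: ('x, 'k) falg)"
    for P and \<ZZ> :: "('x, 'm) mmon"
    unfolding mquot_def option.case mact_right_cancel by simp
  have quot1: "mquot (Some \<ZZ>) \<ZZ> = (of_mon 0 :: ('x, 'k) falg)" for \<ZZ> :: "('x, 'm) mmon"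
    using quot[of 0 \<ZZ>] by (simp add: mact_def)
  have snd: "snd \<XX> = snd \<YY>" and "Z + fst \<XX> = W + fst \<YY>"
    using assms by (simp_all add: mact_def)
  from this(2) consider V where "\<YY> = mact V \<XX>" "Z = W + V" | V where "\<XX> = mact V \<YY>" "W = Z + V"
    by (rule mon_add_eq_add_cases) (simp_all add: mact_def prod_eq_iff snd)
  then show thesis
  proof cases
    case 1
    then have "mlcm \<XX> \<YY> = Some \<YY>" by (auto simp: mlcm_def mdivides_def)
    then show thesis
      using that[of W V 0] 1 quot[of V \<XX>] quot1[of \<YY>] by (simp add: mact_def)
  next
    case 2
    show thesis
    proof (cases "mdivides \<XX> \<YY>")
      \<comment> \<open>Monomials that divide each other are equal. The case has to be singled out because
        \<^const>\<open>mlcm\<close> then returns \<open>\<YY>\<close>, not \<open>\<XX>\<close>.\<close>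
      case True
      then obtain V' where "\<YY> = mact V' \<XX>" by (auto simp: mdivides_def)
      then have "fst \<XX> = (V + V') + fst \<XX>"
        using 2(1) by (metis mact_def mact_mact fst_conv)
      then have "V + V' = 0"
        by (metis add_0 mon_right_cancel)
      then have "V = 0"
        by (cases V; cases V') (simp add: plus_mon_def zero_mon_def)
      then have "\<XX> = \<YY>" using 2(1) by (simp add: mact_def)
      then show thesis
        using that[of Z 0 0] 2 \<open>V = 0\<close> True quot1[of \<YY>] by (simp add: mlcm_def)
    next
      case False
      then have "mlcm \<XX> \<YY> = Some \<XX>" using 2(1) by (auto simp: mlcm_def mdivides_def)
      then show thesis
        using that[of Z 0 V] 2 quot[of V \<YY>] quot1[of \<XX>] by (simp add: mact_def)
    qed
  qed
qed

text \<open>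
  If \<open>Y\<close> is a subword of \<open>Z X\<close>, it lies inside \<open>Z\<close>, or it reaches into \<open>X\<close>, and then \<open>Z\<close> is a
  left multiple of the first component of an overlap.
\<close>

lemma subword_of_product_cases:
  fixes X Y Z U V :: "'x mon"
  assumes "Z + X = U + Y + V"
  obtains W where "Z = U + Y + W"
  | Z' z p q where "(z, p, q) \<in> overlaps (letters X) (letters Y)" "Z = Z' + z" "z + X = p + Y + q"
  using assms
proof (cases rule: mon_add_eq_add_cases)
  case (1 W)
  then show ?thesis using that(1) by blast
next
  case (2 W)
  from 2(1) show ?thesis
  proof (cases rule: mon_add_eq_add_cases)
    case (1 P)
    with 2 have X: "X = P + Y + V" by simp
    then have "(0, P, V) \<in> overlaps (letters X) (letters Y)"
      unfolding overlaps_def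
      by (intro UnI1 CollectI exI[of _ "length (letters P)"]) (simp add: plus_mon_def)
    then show ?thesis
      using that(2)[of 0 P V Z] X by simp
  next
    case P: (2 P)
    then have "(P, 0, V) \<in> overlaps (letters X) (letters Y)"
      unfolding overlaps_def using 2
      by (intro UnI2 CollectI exI[of _ "length (letters P)"]) (simp add: plus_mon_def)
    then show ?thesis
      using that(2)[of P 0 V U] P 2 by (simp add: add.assoc)
  qed
qed

section \<open>Leading monomials of syzygies\<close>

lemma sum_axis_nth: "(\<Sum>\<nu>\<in>UNIV. u \<nu> *s axis \<nu> 1) $ i = (u i :: 'r::ring_1)"
  using basis_expansion[of "\<chi> \<nu>. u \<nu>"] by (metis (no_types, lifting) sum.cong vec_lambda_beta)

lemma vkeys_sum_axis: "vkeys (\<Sum>\<nu>\<in>UNIV. u \<nu> *s axis \<nu> 1) = {(X, \<nu>). X \<in> Poly_Mapping.keys (u \<nu>)}"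
  unfolding vkeys_def sum_axis_nth ..

lemma syz_map_sum_axis: "syz_map g (\<Sum>\<nu>\<in>UNIV. u \<nu> *s axis \<nu> 1) = (\<Sum>\<nu>\<in>UNIV. u \<nu> *s g \<nu>)"
  unfolding syz_map_def sum_axis_nth ..

locale monic_homogeneous_system =
  fixes a :: "'x \<Rightarrow> nat"
    and ro :: "'x mon rel"
    and mo :: "('x, 'm::finite) mmon rel"
    and e :: "'m \<Rightarrow> nat"
    and k :: nat
    and \<Omega> :: "('x, 'k::field) falg set"
    and g :: "'t::finite \<Rightarrow> ('x, 'k) falg ^ 'm"
  assumes ro: "monomial_ordering ro"
    and mo: "term_order mo"
    and compatible: "\<And>X Y i. less_in ro X Y \<Longrightarrow> less_in mo (X, i) (Y, i)"
    and Omega_homogeneous: "\<And>\<omega>. \<omega> \<in> \<Omega> \<Longrightarrow> \<omega> \<noteq> 0 \<and> (\<exists>d. homogeneous a d \<omega>)"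
    and Omega_monic: "\<And>\<omega>. \<omega> \<in> \<Omega> \<Longrightarrow> lc ro \<omega> = 1"
    and Omega_groebner: "ideal_groebner_basis ro \<Omega>"
    and g_monic_homogeneous: "\<And>i. g i \<noteq> 0 \<and> (\<exists>d. vhomogeneous a e d (g i)) \<and> vlc mo (g i) = 1"
begin

lemma linear_ro: "linear_order ro" and linear_mo: "linear_order mo" and well_mo: "well_order mo"
  using ro mo by (auto simp: monomial_ordering_def term_order_def well_order_on_def)

lemma less_mact: "less_in mo \<XX> \<YY> \<Longrightarrow> less_in mo (mact Z \<XX>) (mact Z \<YY>)"
  using mo unfolding term_order_def by blast

lemma le_mact: "(\<XX>, \<YY>) \<in> mo \<Longrightarrow> (mact Z \<XX>, mact Z \<YY>) \<in> mo"
  using less_mact unfolding linear_order_le_iff[OF linear_mo] by blast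

lemma less_mult: "less_in ro X Y \<Longrightarrow> less_in ro (U + X + V) (U + Y + V)"
  using ro by (auto simp: monomial_ordering_def)

lemma less_mact_left: "less_in ro X Y \<Longrightarrow> less_in mo (mact X \<XX>) (mact Y \<XX>)"
  using compatible less_mult[of X Y 0 "fst \<XX>"] by (simp add: mact_def)

lemma le_mact_left: "(X, Y) \<in> ro \<Longrightarrow> (mact X \<XX>, mact Y \<XX>) \<in> mo"
  using less_mact_left
  unfolding linear_order_le_iff[OF linear_mo] linear_order_le_iff[OF linear_ro] by blast

text \<open>
  Both orders being total, compatibility in one direction gives it in the other. The converse is
  needed to read off leading monomials of the entries of a vector from that of the vector.
\<close>

lemma compatible_iff: "less_in mo (X, i) (Y, i) \<longleftrightarrow> less_in ro X Y"
  using compatible linear_order_total[OF linear_ro, of X Y] linear_order_asym[OF linear_mo]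
  by (metis less_in_def)

definition lead :: "'t \<Rightarrow> ('x, 'm) mmon" where
  "lead i = vlm mo (g i)"

definition below :: "('x, 'm) mmon \<Rightarrow> ('x, 'm) mmon set" where
  "below L = {B. less_in mo B L}"

lemma lead_is_greatest: "is_greatest mo (vkeys (g i)) (lead i)"
  using vlm_is_greatest[OF linear_mo, of "g i"] g_monic_homogeneous by (simp add: lead_def)

lemma lead_degree:
  assumes "vhomogeneous a e d (g i)"
  shows "mdeg a (fst (lead i)) + e (snd (lead i)) = d"
proof -
  have "lead i \<in> vkeys (g i)"
    using lead_is_greatest[of i] by (simp add: is_greatest_def)
  then show ?thesis
    using assms unfolding vhomogeneous_def case_prod_unfold by blast
qed

lemma vdeg_homogeneous: "vhomogeneous a e (vdeg a e (g i)) (g i)"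
proof -
  obtain d where d: "vhomogeneous a e d (g i)"
    using g_monic_homogeneous by blast
  have "d' = d" if "vhomogeneous a e d' (g i)" for d'
    using lead_degree[OF d] lead_degree[OF that] by simp
  with d show ?thesis
    unfolding vdeg_def by (rule theI)
qed

lemma vdeg_lead: "vdeg a e (g i) = mdeg a (fst (lead i)) + e (snd (lead i))"
  using lead_degree[OF vdeg_homogeneous] by simp

lemma vkeys_monomial_multiple:
  "vkeys (of_mon Z *s g i - mvec (mact Z (lead i))) \<subseteq> below (mact Z (lead i))"
proof -
  have "Poly_Mapping.lookup (g i $ snd (lead i)) (fst (lead i)) = 1"
    using g_monic_homogeneous by (simp add: vlc_def lead_def)
  then have "vkeys (g i - mvec (lead i)) \<subseteq> below (lead i)"
    using vkeys_minus_lead[of "lead i" "g i" 1] lead_is_greatest[of i]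
    by (auto simp: below_def is_greatest_def less_in_def)
  moreover have "of_mon Z *s g i - mvec (mact Z (lead i)) = of_mon Z *s (g i - mvec (lead i))"
    by (simp add: vector_ssub_ldistrib of_mon_smult_mvec)
  ultimately show ?thesis
    using vkeys_smult[of "of_mon Z" "g i - mvec (lead i)"] less_mact by (fastforce simp: below_def)
qed

text \<open>
  Since \<open>\<omega>\<close> is monic, \<open>p \<omega> q\<close> and its leading monomial differ only in smaller monomials.
\<close>

lemma keys_Omega_multiple:
  assumes "\<omega> \<in> \<Omega>" "X \<in> Poly_Mapping.keys (of_mon p * \<omega> * of_mon q - of_mon (p + lm ro \<omega> + q))"
  shows "less_in ro X (p + lm ro \<omega> + q)"
proof -
  have gr: "is_greatest ro (Poly_Mapping.keys \<omega>) (lm ro \<omega>)"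
    using lm_is_greatest[OF linear_ro] Omega_homogeneous[OF assms(1)] by blast
  have "of_mon p * \<omega> * of_mon q - of_mon (p + lm ro \<omega> + q)
      = of_mon p * (\<omega> - of_mon (lm ro \<omega>)) * of_mon q"
    by (simp add: algebra_simps mult_single)
  then have "X \<in> Poly_Mapping.keys (of_mon p * (\<omega> - of_mon (lm ro \<omega>)) * of_mon q)"
    using assms(2) by simp
  then obtain W where W: "X = W + q" "W \<in> Poly_Mapping.keys (of_mon p * (\<omega> - of_mon (lm ro \<omega>)))"
    using keys_mult[of "of_mon p * (\<omega> - of_mon (lm ro \<omega>))" "of_mon q"] by auto
  then obtain Y where Y: "W = p + Y" "Y \<in> Poly_Mapping.keys (\<omega> - of_mon (lm ro \<omega>))"
    using keys_mult[of "of_mon p" "\<omega> - of_mon (lm ro \<omega>)"] by auto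
  then have "Y \<noteq> lm ro \<omega>" "Y \<in> Poly_Mapping.keys \<omega>"
    using Omega_monic[OF assms(1)]
    by (auto simp: lc_def in_keys_iff lookup_minus lookup_single when_def split: if_splits)
  then have "less_in ro Y (lm ro \<omega>)"
    using gr by (auto simp: is_greatest_def less_in_def)
  then show ?thesis
    by (simp add: W Y less_mult)
qed

text \<open>
  The image of \<open>v\<close> under \<open>\<phi>\<close> can be estimated without knowing whether its leading terms cancel.
\<close>

lemma vkeys_syz_map:
  assumes "\<And>Z i. (Z, i) \<in> vkeys v \<Longrightarrow> less_in mo (mact Z (lead i)) L"
  shows "vkeys (syz_map g v) \<subseteq> below L"
proof
  fix B assume "B \<in> vkeys (syz_map g v)"
  then obtain i where "B \<in> vkeys (v $ i *s g i)"
    using vkeys_sum[of "\<lambda>i. v $ i *s g i" UNIV] by (auto simp: syz_map_def)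
  then obtain Z \<YY> where Z: "B = mact Z \<YY>" "Z \<in> Poly_Mapping.keys (v $ i)" "\<YY> \<in> vkeys (g i)"
    using vkeys_smult by blast
  then have "(B, mact Z (lead i)) \<in> mo"
    using lead_is_greatest[of i] by (auto simp: is_greatest_def le_mact)
  moreover have "less_in mo (mact Z (lead i)) L"
    using assms Z(2) by (auto simp: vkeys_def)
  ultimately show "B \<in> below L"
    by (simp add: below_def linear_order_le_less_trans[OF linear_mo])
qed

lemma standard_rep_below:
  assumes "standard_rep a ro mo e \<Omega> k g S u" "vkeys S \<subseteq> below L" "X \<in> Poly_Mapping.keys (u \<nu>)"
  shows "less_in mo (mact X (lead \<nu>)) L"
proof -
  from assms(3) have u: "u \<nu> \<noteq> 0" by auto
  obtain T where T: "{mact (lm ro (u \<nu>)) (vlm mo (g \<nu>)) | \<nu>. u \<nu> \<noteq> 0} \<subseteq> T"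
    "if S = 0 then T = {} else is_greatest mo T (vlm mo S)"
    using assms(1) unfolding standard_rep_def Let_def
    by (elim exE conjE) (rule that[OF Un_upper1])
  have "mact (lm ro (u \<nu>)) (lead \<nu>) \<in> T"
    using u by (intro subsetD[OF T(1)]) (auto simp: lead_def)
  then have "S \<noteq> 0" "(mact (lm ro (u \<nu>)) (lead \<nu>), vlm mo S) \<in> mo"
    using T(2) by (auto simp: is_greatest_def split: if_splits)
  moreover have "(mact X (lead \<nu>), mact (lm ro (u \<nu>)) (lead \<nu>)) \<in> mo"
    using lm_is_greatest[OF linear_ro u] assms(3) by (auto simp: is_greatest_def le_mact_left)
  moreover have "less_in mo (vlm mo S) L" if "S \<noteq> 0"
    using vlm_is_greatest[OF linear_mo that] assms(2) by (auto simp: is_greatest_def below_def)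
  ultimately show ?thesis
    using linear_order_le_less_trans[OF linear_mo] by blast
qed

lemma standard_rep_remainder:
  assumes "standard_rep a ro mo e \<Omega> k g S u"
  shows "(S - (\<Sum>\<nu>\<in>UNIV. u \<nu> *s g \<nu>)) $ j \<in> Omega_ideal a \<Omega> (int k - int (e j))"
proof -
  note I = two_sided_ideal_Omega_ideal[of a \<Omega> "int k - int (e j)"]
  obtain ts :: "(('x, 'k) falg \<times> ('x, 'k) falg \<times> ('x, 'k) falg \<times> 'm) list"
    where ts: "\<forall>(p, \<omega>, q, i) \<in> set ts. \<omega> \<in> Omega_upto a \<Omega> (int k - int (e i))"
      and S: "S = (\<Sum>\<nu>\<in>UNIV. u \<nu> *s g \<nu>) + (\<Sum>(p, \<omega>, q, i)\<leftarrow>ts. (p * \<omega> * q) *s axis i 1)"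
    using assms unfolding standard_rep_def by blast
  have "(\<Sum>(p, \<omega>, q, i)\<leftarrow>ts. (p * \<omega> * q) *s axis i 1) $ j \<in> Omega_ideal a \<Omega> (int k - int (e j))"
    using ts
  proof (induction ts)
    case Nil
    then show ?case using I by (simp add: two_sided_ideal_def)
  next
    case (Cons t ts)
    obtain p \<omega> q i where t: "t = (p, \<omega>, q, i)" by (metis prod_cases4)
    have "((p * \<omega> * q) *s axis i 1) $ j \<in> Omega_ideal a \<Omega> (int k - int (e j))"
    proof (cases "i = j")
      case True
      then have "\<omega> \<in> Omega_ideal a \<Omega> (int k - int (e j))"
        using Cons.prems Omega_upto_subset by (auto simp: t)
      then show ?thesis
        using True two_sided_ideal_mult[OF I] by simp
    next
      case False
      then show ?thesis
        using I by (simp add: axis_def two_sided_ideal_def)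
    qed
    then show ?case
      using Cons I by (simp add: t two_sided_ideal_def)
  qed
  then show ?thesis by (simp add: S)
qed

abbreviation source_order :: "('x, 't) mmon rel" where
  "source_order \<equiv> schreyer_order mo lead"

lemma well_source_order: "well_order source_order"
  by (rule well_order_schreyer_order[OF well_mo])

lemma linear_source_order: "linear_order source_order"
  using well_source_order by (simp add: well_order_on_def)

lemma source_lessI:
  "less_in mo (mact W (lead j)) (mact Z (lead i)) \<Longrightarrow> less_in source_order (W, j) (Z, i)"
  by (simp add: less_in_schreyer_order schreyer_less_def)

text \<open>
  In both kinds of generating syzygies the coefficients that come from the standard representation
  are negligible, because \<open>S\<close> has lost the common leading monomial of its two parts.
\<close>

lemma standard_rep_source_below:
  assumes "standard_rep a ro mo e \<Omega> k g S u" "vkeys S \<subseteq> below L" "mact V L = mact Z (lead i)"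
    and "B \<in> vkeys (of_mon V *s (\<Sum>\<nu>\<in>UNIV. u \<nu> *s axis \<nu> 1))"
  shows "less_in source_order B (Z, i)"
proof -
  obtain X \<nu> where B: "B = (V + X, \<nu>)" "X \<in> Poly_Mapping.keys (u \<nu>)"
    using vkeys_smult[of "of_mon V" "\<Sum>\<nu>\<in>UNIV. u \<nu> *s axis \<nu> 1"] assms(4)
    by (auto simp: vkeys_sum_axis mact_def)
  have "less_in mo (mact X (lead \<nu>)) L"
    using standard_rep_below[OF assms(1,2) B(2)] .
  then have "less_in mo (mact V (mact X (lead \<nu>))) (mact V L)"
    by (rule less_mact)
  then show ?thesis
    unfolding B(1) by (intro source_lessI) (simp add: mact_mact assms(3))
qed

lemma syz_pair_lead:
  assumes rep: "standard_rep a ro mo e \<Omega> k g (S_pair mo g i j) u"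
    and eq: "mact Z (lead i) = mact W (lead j)" and less: "less_in source_order (W, j) (Z, i)"
  shows "\<exists>V. \<forall>B\<in>vkeys (of_mon V *s syz_pair mo g u i j - mvec (Z, i)). less_in source_order B (Z, i)"
proof -
  obtain V P Q where VPQ: "Z = V + P" "W = V + Q" and PQ: "mact P (lead i) = mact Q (lead j)"
    and quot: "mquot (mlcm (lead i) (lead j)) (lead i) = (of_mon P :: ('x, 'k) falg)"
      "mquot (mlcm (lead i) (lead j)) (lead j) = (of_mon Q :: ('x, 'k) falg)"
    using mlcm_common_multiple[OF eq] by blast
  have "S_pair mo g i j = (of_mon P *s g i - mvec (mact P (lead i)))
      - (of_mon Q *s g j - mvec (mact Q (lead j)))"
    using quot by (simp add: S_pair_def Let_def lead_def[symmetric] PQ)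
  then have S: "vkeys (S_pair mo g i j) \<subseteq> below (mact P (lead i))"
    using vkeys_monomial_multiple[of P i] vkeys_monomial_multiple[of Q j] PQ
    by (simp only: vkeys_diff_subset)
  have "syz_pair mo g u i j = mvec (P, i) - mvec (Q, j) - (\<Sum>\<nu>\<in>UNIV. u \<nu> *s axis \<nu> 1)"
    using quot by (simp add: syz_pair_def Let_def lead_def[symmetric] mvec_def)
  then have "of_mon V *s syz_pair mo g u i j - mvec (Z, i)
      = 0 - mvec (W, j) - of_mon V *s (\<Sum>\<nu>\<in>UNIV. u \<nu> *s axis \<nu> 1)"
    by (simp add: vector_ssub_ldistrib of_mon_smult_mvec mact_def VPQ)
  then have "vkeys (of_mon V *s syz_pair mo g u i j - mvec (Z, i))
      \<subseteq> {(W, j)} \<union> vkeys (of_mon V *s (\<Sum>\<nu>\<in>UNIV. u \<nu> *s axis \<nu> 1))"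
    using vkeys_diff[of "0 - mvec (W, j)" "of_mon V *s (\<Sum>\<nu>\<in>UNIV. u \<nu> *s axis \<nu> 1)"]
      vkeys_diff[of 0 "mvec (W, j) :: ('x, 'k) falg ^ 't"]
    by (auto simp: vkeys_mvec)
  then show ?thesis
    using less standard_rep_source_below[OF rep S, of V Z i]
    by (intro exI[of _ V]) (auto simp: VPQ mact_mact)
qed

lemma syz_omega_lead:
  assumes rep: "standard_rep a ro mo e \<Omega> k g (S_omega mo g i \<omega> (z, p, q)) h"
    and \<omega>: "\<omega> \<in> \<Omega>" and eq: "z + fst (lead i) = p + lm ro \<omega> + q"
  shows "\<forall>B\<in>vkeys (of_mon V *s syz_omega h i (z, p, q) - mvec (V + z, i)).
           less_in source_order B (V + z, i)"
proof -
  let ?L = "mact z (lead i)"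
  have L: "?L = (p + lm ro \<omega> + q, snd (lead i))"
    by (simp add: mact_def eq)
  have "S_omega mo g i \<omega> (z, p, q) = (of_mon z *s g i - mvec ?L)
      - (of_mon p * \<omega> * of_mon q - of_mon (p + lm ro \<omega> + q)) *s axis (snd (lead i)) 1"
    by (simp add: S_omega_def lead_def[symmetric] L mvec_def vector_sub_rdistrib)
  moreover have "vkeys ((of_mon p * \<omega> * of_mon q - of_mon (p + lm ro \<omega> + q)) *s axis (snd (lead i)) 1)
      \<subseteq> below ?L"
    unfolding vkeys_smult_axis using keys_Omega_multiple[OF \<omega>]
    by (auto simp: below_def L compatible)
  ultimately have S: "vkeys (S_omega mo g i \<omega> (z, p, q)) \<subseteq> below ?L"
    using vkeys_monomial_multiple[of z i] by (simp only: vkeys_diff_subset)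
  have "of_mon V *s syz_omega h i (z, p, q) - mvec (V + z, i)
      = 0 - of_mon V *s (\<Sum>\<nu>\<in>UNIV. h \<nu> *s axis \<nu> 1)"
    by (simp add: syz_omega_def mvec_def vector_ssub_ldistrib vector_smult_assoc mult_single)
  then have "vkeys (of_mon V *s syz_omega h i (z, p, q) - mvec (V + z, i))
      \<subseteq> vkeys (of_mon V *s (\<Sum>\<nu>\<in>UNIV. h \<nu> *s axis \<nu> 1))"
    using vkeys_diff[of 0 "of_mon V *s (\<Sum>\<nu>\<in>UNIV. h \<nu> *s axis \<nu> 1)"] by auto
  then show ?thesis
    using standard_rep_source_below[OF rep S, of V "V + z" i] by (auto simp: mact_mact)
qed

text \<open>
  The leading monomial \<open>Z e'\<^sub>i\<close> of an element of the syzygy module either ties with another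
  monomial, or \<open>Z\<close> times the leading monomial of \<open>g\<^sub>i\<close> survives in \<open>\<phi>(v)\<close>. In the second case it
  is the leading monomial of an element of the ideal \<open>\<langle>\<Omega>(k - |e\<^sub>\<mu>|)\<rangle>\<close>.
\<close>

lemma leading_monomial_cases:
  assumes v: "v \<in> Omega_syz a e \<Omega> k g" "v \<noteq> 0" and lead_v: "vlm source_order v = (Z, i)"
  obtains W j where "mact Z (lead i) = mact W (lead j)" "less_in source_order (W, j) (Z, i)"
  | "int k - int (e (snd (lead i))) < int (mdeg a (Z + fst (lead i)))"
  | \<omega> U V d where "\<omega> \<in> \<Omega>" "homogeneous a d \<omega>" "d \<le> k" "Z + fst (lead i) = U + lm ro \<omega> + V"
proof (cases "\<exists>W j. (W, j) \<in> vkeys v \<and> (W, j) \<noteq> (Z, i) \<and> mact W (lead j) = mact Z (lead i)")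
  case True
  then show thesis
    using vlm_is_greatest[OF linear_source_order v(2)] lead_v that(1)
    by (metis is_greatest_def less_in_def)
next
  case False
  let ?L = "mact Z (lead i)"
  obtain Y \<mu> where L: "?L = (Y, \<mu>)" by (cases ?L)
  then have Y: "Y = Z + fst (lead i)" "\<mu> = snd (lead i)"
    by (auto simp: mact_def)
  have top: "is_greatest source_order (vkeys v) (Z, i)"
    using vlm_is_greatest[OF linear_source_order v(2)] lead_v by simp
  define c where "c = Poly_Mapping.lookup (v $ i) Z"
  have c: "c \<noteq> 0"
    using top by (auto simp: is_greatest_def vkeys_def c_def in_keys_iff)
  define v' where "v' = v - Poly_Mapping.single 0 c *s mvec (Z, i)"
  have v': "vkeys v' = vkeys v - {(Z, i)}"
    unfolding v'_def using top by (intro vkeys_minus_lead) (auto simp: c_def is_greatest_def)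
  \<comment> \<open>Without a tie only the leading term of \<open>v\<close> contributes to the coefficient of \<open>?L\<close> in \<open>\<phi>(v)\<close>,
    which is therefore \<open>c\<close>.\<close>
  have "vkeys (syz_map g v') \<subseteq> below ?L"
  proof (rule vkeys_syz_map)
    fix W j assume "(W, j) \<in> vkeys v'"
    then have "(W, j) \<in> vkeys v" "(W, j) \<noteq> (Z, i)"
      by (auto simp: v')
    then have "less_in source_order (W, j) (Z, i)" "mact W (lead j) \<noteq> ?L"
      using top False by (auto simp: is_greatest_def less_in_def)
    then show "less_in mo (mact W (lead j)) ?L"
      by (auto simp: less_in_schreyer_order schreyer_less_def)
  qed
  moreover have "syz_map g v - Poly_Mapping.single 0 c *s mvec ?L
      = syz_map g v' + Poly_Mapping.single 0 c *s (of_mon Z *s g i - mvec ?L)"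
    by (simp add: v'_def syz_map_diff syz_map_smult mvec_def syz_map_axis vector_ssub_ldistrib)
  moreover have "vkeys (Poly_Mapping.single 0 c *s (of_mon Z *s g i - mvec ?L)) \<subseteq> below ?L"
    using vkeys_monomial_multiple[of Z i]
      vkeys_smult[of "Poly_Mapping.single 0 c" "of_mon Z *s g i - mvec ?L"]
    by (auto simp: mact_def split: if_splits)
  ultimately have "vkeys (syz_map g v - Poly_Mapping.single 0 c *s mvec ?L) \<subseteq> below ?L"
    by (simp only: vkeys_add_subset)
  then have below: "less_in ro X Y"
    if "X \<in> Poly_Mapping.keys ((syz_map g v - Poly_Mapping.single 0 c *s mvec ?L) $ \<mu>)" for X
    using that by (auto simp: vkeys_def below_def L compatible_iff)
  define f where "f = syz_map g v $ \<mu>"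
  have "(syz_map g v - Poly_Mapping.single 0 c *s mvec ?L) $ \<mu> = f - Poly_Mapping.single Y c"
    by (simp add: f_def L mvec_def mult_single)
  then have tail: "less_in ro X Y" if "X \<in> Poly_Mapping.keys (f - Poly_Mapping.single Y c)" for X
    using below that by simp
  have "Y \<in> Poly_Mapping.keys f"
    using tail[of Y] c by (auto simp: less_in_def in_keys_iff lookup_minus)
  moreover have "less_in ro X Y" if "X \<in> Poly_Mapping.keys f" "X \<noteq> Y" for X
    using that by (intro tail) (auto simp: in_keys_iff lookup_minus lookup_single)
  ultimately have gr: "is_greatest ro (Poly_Mapping.keys f) Y"
    by (auto simp: is_greatest_def linear_order_le_iff[OF linear_ro])
  then have f: "f \<noteq> 0" "lm ro f = Y"
    using lm_eqI[OF linear_ro] by (auto simp: is_greatest_def)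
  have fI: "f \<in> Omega_ideal a \<Omega> (int k - int (e \<mu>))"
    using v(1) by (simp add: Omega_syz_def f_def)
  have "\<forall>\<omega>\<in>\<Omega>. \<omega> \<noteq> 0 \<and> (\<exists>n. homogeneous a n \<omega>)"
    using Omega_homogeneous by blast
  from linear_ro this Omega_groebner fI f(1) show thesis
  proof (cases rule: lm_Omega_ideal)
    case 1
    then show thesis using that(2) by (simp add: f Y)
  next
    case (2 \<omega> U V d)
    then show thesis using that(3)[of \<omega> d U V] by (simp add: f Y)
  qed
qed

text \<open>
  The entry of \<open>g\<^sub>i\<close> at \<open>j\<close> has degree \<open>|g\<^sub>i| - |e\<^sub>j|\<close>. This is exactly the difference between the
  degree bounds of the ideals at \<open>e'\<^sub>i\<close> and at \<open>e\<^sub>j\<close>.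
\<close>

lemma smult_axis_in_Omega_syz:
  assumes "q \<in> Omega_ideal a \<Omega> (int k - int (vdeg a e (g i)))"
  shows "q *s axis i 1 \<in> Omega_syz a e \<Omega> k g"
proof -
  have "q * g i $ j \<in> Omega_ideal a \<Omega> (int k - int (e j))" for j
  proof (cases "g i $ j = 0")
    case True
    then show ?thesis
      using two_sided_ideal_Omega_ideal[of a \<Omega>] by (auto simp: two_sided_ideal_def)
  next
    case False
    have deg: "mdeg a X + e j = vdeg a e (g i)" if "X \<in> Poly_Mapping.keys (g i $ j)" for X
      using vdeg_homogeneous[of i] that by (auto simp: vhomogeneous_def vkeys_def)
    obtain X where "X \<in> Poly_Mapping.keys (g i $ j)"
      using False by (metis ex_in_conv keys_eq_empty)
    from deg[OF this] have "q \<in> Omega_ideal a \<Omega> (int k - int (e j) - int (vdeg a e (g i) - e j))"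
      using assms by (simp add: of_nat_diff)
    then show ?thesis
      by (rule Omega_ideal_times_high_degree) (use deg in fastforce)
  qed
  then show ?thesis
    by (simp add: Omega_syz_def syz_map_smult syz_map_axis)
qed

lemma syz_pair_in_Omega_syz:
  assumes "standard_rep a ro mo e \<Omega> k g (S_pair mo g i j) u"
  shows "syz_pair mo g u i j \<in> Omega_syz a e \<Omega> k g"
proof -
  have "syz_map g (syz_pair mo g u i j) = S_pair mo g i j - (\<Sum>\<nu>\<in>UNIV. u \<nu> *s g \<nu>)"
    by (simp add: syz_pair_def S_pair_def Let_def syz_map_diff syz_map_smult syz_map_axis
        syz_map_sum_axis)
  then show ?thesis
    using standard_rep_remainder[OF assms] by (simp add: Omega_syz_def)
qed

lemma syz_omega_in_Omega_syz:
  assumes rep: "standard_rep a ro mo e \<Omega> k g (S_omega mo g i \<omega> c) h" and \<omega>: "\<omega> \<in> \<Omega>"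
  shows "syz_omega h i c \<in> Omega_syz a e \<Omega> k g"
proof -
  obtain z p q where c: "c = (z, p, q)" by (metis prod_cases3)
  define \<mu> where "\<mu> = snd (lead i)"
  have "syz_map g (syz_omega h i c) = (S_omega mo g i \<omega> c - (\<Sum>\<nu>\<in>UNIV. h \<nu> *s g \<nu>))
      + (of_mon p * \<omega> * of_mon q) *s axis \<mu> 1"
    by (simp add: c syz_omega_def S_omega_def syz_map_diff syz_map_smult syz_map_axis
        syz_map_sum_axis \<mu>_def lead_def)
  moreover have "((of_mon p * \<omega> * of_mon q) *s axis \<mu> 1) $ j \<in> Omega_ideal a \<Omega> (int k - int (e j))" for j
  proof -
    have "\<omega> \<in> Omega_ideal a \<Omega> (int k - int (e j))"
      using \<omega> Omega_upto_subset by (auto simp: Omega_upto_def)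
    then have "of_mon p * \<omega> * of_mon q * axis \<mu> 1 $ j \<in> Omega_ideal a \<Omega> (int k - int (e j))"
      by (intro two_sided_ideal_mult[OF two_sided_ideal_Omega_ideal])
    then show ?thesis by simp
  qed
  ultimately show ?thesis
    using standard_rep_remainder[OF rep] two_sided_ideal_Omega_ideal[of a \<Omega>]
    by (auto simp: Omega_syz_def two_sided_ideal_def)
qed

text \<open>
  Each outcome of \<open>leading_monomial_cases\<close> supplies a monic element of the generated module with
  the leading monomial \<open>Z e'\<^sub>i\<close>: a tie gives a multiple of some \<open>s\<^sub>i\<^sub>j\<close>, large degree puts \<open>Z\<close>
  itself into \<open>\<langle>\<Omega>(k - |g\<^sub>i|)\<rangle>\<close>, and if \<open>lm \<omega>\<close> is a subword of \<open>Z X\<^sub>i\<close>, there is either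
  a multiple of \<open>\<omega>\<close> with leading monomial \<open>Z\<close>, or a multiple of some \<open>s\<^sub>i(\<omega>; z, p, q)\<close>.
\<close>

lemma Omega_syz_generated:
  assumes pair: "\<And>i j. standard_rep a ro mo e \<Omega> k g (S_pair mo g i j) (u i j)"
    and omega: "\<And>i \<omega> c. \<omega> \<in> \<Omega> \<Longrightarrow> (\<exists>d\<le>k. homogeneous a d \<omega>) \<Longrightarrow> c \<in> C_set ro mo (g i) \<omega> \<Longrightarrow>
           standard_rep a ro mo e \<Omega> k g (S_omega mo g i \<omega> c) (h i \<omega> c)"
  shows "Omega_syz a e \<Omega> k g =
         Omega_gen a (\<lambda>i. vdeg a e (g i)) \<Omega> k
           ({syz_pair mo g (u i j) i j | i j. True} \<union>
            {syz_omega (h i \<omega> c) i c | i \<omega> c.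
               \<omega> \<in> \<Omega> \<and> (\<exists>d\<le>k. homogeneous a d \<omega>) \<and> c \<in> C_set ro mo (g i) \<omega>})"
    (is "_ = ?G")
proof (rule submodule_eq_by_reduction[OF well_source_order left_submodule_Omega_syz
      left_submodule_Omega_gen])
  show "?G \<subseteq> Omega_syz a e \<Omega> k g"
    using syz_pair_in_Omega_syz[OF pair] syz_omega_in_Omega_syz[OF omega] smult_axis_in_Omega_syz
    by (intro Omega_gen_minimal left_submodule_Omega_syz) blast+
next
  fix v assume v: "v \<in> Omega_syz a e \<Omega> k g" "v \<noteq> 0"
  obtain Z i where Zi: "vlm source_order v = (Z, i)" by (cases "vlm source_order v")
  note smult_G = left_submoduleD(3)[OF left_submodule_Omega_gen]
  from v Zi have "\<exists>s\<in>?G. \<forall>B\<in>vkeys (s - mvec (Z, i)). less_in source_order B (Z, i)"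
  proof (cases rule: leading_monomial_cases)
    case (1 W j)
    obtain V where
      "\<forall>B\<in>vkeys (of_mon V *s syz_pair mo g (u i j) i j - mvec (Z, i)). less_in source_order B (Z, i)"
      using syz_pair_lead[OF pair 1] by blast
    moreover have "of_mon V *s syz_pair mo g (u i j) i j \<in> ?G"
      by (intro smult_G generator_in_Omega_gen) blast
    ultimately show ?thesis by blast
  next
    case 2
    have "mvec (Z, i) \<in> ?G"
      unfolding mvec_def fst_conv snd_conv
    proof (rule ideal_part_in_Omega_gen, rule high_degree_in_Omega_ideal)
      fix X assume "X \<in> Poly_Mapping.keys (of_mon Z :: ('x, 'k) falg)"
      then show "int k - int (vdeg a e (g i)) < int (mdeg a X)"
        using 2 by (simp add: vdeg_lead mdeg_add)
    qed
    moreover have "vkeys (mvec (Z, i) - mvec (Z, i) :: ('x, 'k) falg ^ 't) = {}"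
      by (simp add: vkeys_eq_empty)
    ultimately show ?thesis by blast
  next
    case (3 \<omega> U V d)
    from 3(4) show ?thesis
    proof (cases rule: subword_of_product_cases)
      case (1 W)
      let ?s = "(of_mon U * \<omega> * of_mon W) *s axis i 1"
      have "\<omega> \<in> Omega_ideal a \<Omega> (int k - int (vdeg a e (g i)))"
        using 3(1) Omega_upto_subset by (auto simp: Omega_upto_def)
      then have "?s \<in> ?G"
        by (intro ideal_part_in_Omega_gen two_sided_ideal_mult[OF two_sided_ideal_Omega_ideal])
      moreover have "less_in source_order B (Z, i)" if B: "B \<in> vkeys (?s - mvec (Z, i))" for B
      proof -
        have "?s - mvec (Z, i)
            = (of_mon U * \<omega> * of_mon W - of_mon (U + lm ro \<omega> + W)) *s axis i 1"
          by (simp add: mvec_def 1 vector_sub_rdistrib)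
        then obtain X where "B = (X, i)"
          "X \<in> Poly_Mapping.keys (of_mon U * \<omega> * of_mon W - of_mon (U + lm ro \<omega> + W))"
          using B by (auto simp: vkeys_smult_axis)
        moreover from this(2) have "less_in ro X Z"
          unfolding 1 by (rule keys_Omega_multiple[OF 3(1)])
        ultimately have "B = (X, i)" "less_in ro X Z" by simp_all
        then show ?thesis
          using source_lessI less_mact_left by blast
      qed
      ultimately show ?thesis by blast
    next
      case (2 Z' z p q)
      have C: "(z, p, q) \<in> C_set ro mo (g i) \<omega>"
        using 2(1) by (simp add: C_set_def lead_def)
      have "of_mon Z' *s syz_omega (h i \<omega> (z, p, q)) i (z, p, q) \<in> ?G"
        using C 3 by (intro smult_G generator_in_Omega_gen) blast
      then show ?thesis
        using syz_omega_lead[OF omega[OF 3(1) _ C] 3(1) 2(3), of Z'] 3(2,3) 2(2) by blast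
    qed
  qed
  then show "\<exists>s\<in>?G. \<forall>B\<in>vkeys (s - mvec (vlm source_order v)).
      less_in source_order B (vlm source_order v)"
    by (simp add: Zi)
qed

end

theorem theorem2p15:
  fixes a :: "'x::countable \<Rightarrow> nat"
    and ro :: "'x mon rel"
    and mo :: "('x, 'm::finite) mmon rel"
    and e :: "'m \<Rightarrow> nat"
    and k :: nat
    and \<Omega> :: "('x, 'k::field) falg set"
    and g :: "'t::finite \<Rightarrow> ('x, 'k) falg ^ 'm"
    and u :: "'t \<Rightarrow> 't \<Rightarrow> 't \<Rightarrow> ('x, 'k) falg"
    and h :: "'t \<Rightarrow> ('x, 'k) falg \<Rightarrow> 'x mon \<times> 'x mon \<times> 'x mon \<Rightarrow> 't \<Rightarrow> ('x, 'k) falg"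
  assumes "\<And>x. a x > 0"
    and "monomial_ordering ro"
    and "term_order mo"
    and "\<And>X Y i. less_in ro X Y \<Longrightarrow> less_in mo (X, i) (Y, i)"
    and "k > 0"
    and "\<And>\<omega>. \<omega> \<in> \<Omega> \<Longrightarrow> \<omega> \<noteq> 0 \<and> (\<exists>d. homogeneous a d \<omega>)"
    and "\<And>\<omega>. \<omega> \<in> \<Omega> \<Longrightarrow> lc ro \<omega> = 1"
    and "ideal_groebner_basis ro \<Omega>"
    and "Omega_groebner_basis a e mo \<Omega> k g"
    and "\<And>i. g i \<noteq> 0 \<and> (\<exists>d. vhomogeneous a e d (g i)) \<and> vlc mo (g i) = 1"
    and "\<And>i j. standard_rep a ro mo e \<Omega> k g (S_pair mo g i j) (u i j)"
    and "\<And>i \<omega> c. \<omega> \<in> \<Omega> \<Longrightarrow> (\<exists>d\<le>k. homogeneous a d \<omega>) \<Longrightarrow> c \<in> C_set ro mo (g i) \<omega> \<Longrightarrow>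
           standard_rep a ro mo e \<Omega> k g (S_omega mo g i \<omega> c) (h i \<omega> c)"
  shows "Omega_syz a e \<Omega> k g =
         Omega_gen a (\<lambda>i. vdeg a e (g i)) \<Omega> k
           ({syz_pair mo g (u i j) i j | i j. True} \<union>
            {syz_omega (h i \<omega> c) i c | i \<omega> c.
               \<omega> \<in> \<Omega> \<and> (\<exists>d\<le>k. homogeneous a d \<omega>) \<and> c \<in> C_set ro mo (g i) \<omega>})"
proof -
  interpret monic_homogeneous_system a ro mo e k \<Omega> g
    using assms(2-4,6-8,10) by unfold_locales
  show ?thesis
    using assms(11,12) by (rule Omega_syz_generated)
qed

end
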